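(* Let $\mathcal X$ be a complete separable metric space, $K$ a continuous positive definite kernel on $\mathcal X\times\mathcal X$ with RKHS $\mathcal H_K$ and feature map $\Phi$. Let $\mathbf X=[x_1,\dots,x_m]$, $\mathbf Y=[y_1,\dots,y_m]$ be points in $\mathcal X$, with Gram matrices $K[\mathbf X]_{ij}=K(x_i,x_j)$, $K[\mathbf Y]_{ij}=K(y_i,y_j)$, $K[\mathbf X,\mathbf Y]_{ij}=K(x_i,y_j)$, $K[\mathbf Y,\mathbf X]=K[\mathbf X,\mathbf Y]^T$. Let $J_m=I_m-\frac1m\mathbf 1_m\mathbf 1_m^T$, and define the empirical mean and covariance $\mu_{\Phi(\mathbf X)}=\frac1m\sum_j\Phi(x_j)$, $C_{\Phi(\mathbf X)}=\frac1m\Phi(\mathbf X)J_m\Phi(\mathbf X)^*$ (similarly for $\mathbf Y$), where $\Phi(\mathbf X):\mathbb R^m\to\mathcal H_K$, $b\mapsto\sum_jb_j\Phi(x_j)$. Let $\mu_0=\mathcal N(\mu_{\Phi(\mathbf X)},C_{\Phi(\mathbf X)})$, $\mu_1=\mathcal N(\mu_{\Phi(\mathbf Y)},C_{\Phi(\mathbf Y)})$ on $\mathcal H_K$, $\epsilon>0$, and write $P=J_mK[\mathbf X,\mathbf Y]J_mK[\mathbf Y,\mathbf X]J_m$, $c=\frac{16}{\epsilon^2m^2}$. Then $$\mathrm{OT}^\epsilon_{d^2}(\mu_0,\mu_1)=\tfrac1{m^2}\mathbf 1_m^T(K[\mathbf X]+K[\mathbf Y]-2K[\mathbf X,\mathbf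 Y])\mathbf 1_m+\tfrac1m\mathrm{Tr}(K[\mathbf X]J_m)+\tfrac1m\mathrm{Tr}(K[\mathbf Y]J_m)-\tfrac\epsilon2\mathrm{Tr}[-I+(I+cP)^{1/2}]+\tfrac\epsilon2\log\det\big(\tfrac12I+\tfrac12(I+cP)^{1/2}\big),$$ $$\begin{aligned}S^\epsilon_{d^2}(\mu_0,\mu_1)=&\tfrac1{m^2}\mathbf 1_m^T(K[\mathbf X]+K[\mathbf Y]-2K[\mathbf X,\mathbf Y])\mathbf 1_m+\tfrac\epsilon4\mathrm{Tr}[-I+(I+c(J_mK[\mathbf X]J_m)^2)^{1/2}]+\tfrac\epsilon4\mathrm{Tr}[-I+(I+c(J_mK[\mathbf Y]J_m)^2)^{1/2}]\\&-\tfrac\epsilon2\mathrm{Tr}[-I+(I+cP)^{1/2}]+\tfrac\epsilon2\log\det\big(\tfrac12I+\tfrac12(I+cP)^{1/2}\big)\\&-\tfrac\epsilon4\log\det\big(\tfrac12I+\tfrac12(I+c(J_mK[\mathbf X]J_m)^2)^{1/2}\big)-\tfrac\epsilon4\log\det\big(\tfrac12I+\tfrac12(I+c(J_mK[\mathbf Y]J_m)^2)^{1/2}\big),\end{aligned}$$ all matrices being $m\times m$. Moreover $\lim_{\epsilon\to\infty}S^\epsilon_{d^2}(\mu_0,\mu_1)=\|\mu_{\Phi(\mathbf X)}-\mu_{\Phi(\mathbf Y)}\|^2_{\mathcal H_K}=\frac1{m^2}\mathbf 1_m^T(K[\mathbf X]+K[\mathbf Y]-2K[\mathbf X,\mathbf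 Y])\mathbf 1_m$ and $\lim_{\epsilon\to0}S^\epsilon_{d^2}(\mu_0,\mu_1)=\frac1{m^2}\mathbf 1_m^T(K[\mathbf X]+K[\mathbf Y]-2K[\mathbf X,\mathbf Y])\mathbf 1_m+\frac1m\mathrm{Tr}(K[\mathbf X]J_m)+\frac1m\mathrm{Tr}(K[\mathbf Y]J_m)-\frac2m\mathrm{Tr}[P^{1/2}]$.
   Context: $\mathcal N(m,C)$ is the Gaussian measure on the Hilbert space $\mathcal H_K$ with mean $m$ and covariance $C$ (positive, trace class). $\mathrm{OT}^\epsilon_{d^2}(\mu,\nu)=\min_{\gamma\in\mathrm{Joint}(\mu,\nu)}\{\int\|x-y\|^2d\gamma+\epsilon\mathrm{KL}(\gamma\|\mu\otimes\nu)\}$ where $\mathrm{Joint}$ is the set of couplings and $\mathrm{KL}$ the Kullback–Leibler divergence; $S^\epsilon_{d^2}(\mu,\nu)=\mathrm{OT}^\epsilon_{d^2}(\mu,\nu)-\frac12(\mathrm{OT}^\epsilon_{d^2}(\mu,\mu)+\mathrm{OT}^\epsilon_{d^2}(\nu,\nu))$. $P^{1/2}$ is the square root of the positive semidefinite matrix $P$. *)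

theory Defs
  imports "HOL-Analysis.Analysis" "HOL-Probability.Probability"
begin

definition pos_def_kernel :: "('x \<Rightarrow> 'x \<Rightarrow> real) \<Rightarrow> bool" where
  "pos_def_kernel K \<longleftrightarrow> (\<forall>x y. K x y = K y x) \<and>
     (\<forall>(xs :: 'x list) (c :: real list). length c = length xs \<longrightarrow>
        0 \<le> (\<Sum>i<length xs. \<Sum>j<length xs. c!i * c!j * K (xs!i) (xs!j)))"

text \<open>The RKHS H_K with feature map Phi, abstractly: a real Hilbert space 'h and a map
  Phi with K x y = <Phi x, Phi y> whose image spans a dense subspace
  (this determines (H_K, Phi) up to isometric isomorphism).\<close>

definition is_RKHS_feature_map :: "('x \<Rightarrow> 'x \<Rightarrow> real) \<Rightarrow> ('x \<Rightarrow> 'h::real_inner) \<Rightarrow> bool" where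
  "is_RKHS_feature_map K \<Phi> \<longleftrightarrow> (\<forall>x y. K x y = \<Phi> x \<bullet> \<Phi> y) \<and> closure (span (range \<Phi>)) = UNIV"

definition normal_measure :: "real \<Rightarrow> real \<Rightarrow> real measure" where
  "normal_measure a v = (if v = 0 then return borel a else density lborel (normal_density a (sqrt v)))"

definition is_gaussian :: "'h::real_inner measure \<Rightarrow> 'h \<Rightarrow> ('h \<Rightarrow> 'h) \<Rightarrow> bool" where
  "is_gaussian M m C \<longleftrightarrow> prob_space M \<and> sets M = sets borel \<and>
     (\<forall>h. distr M borel (\<lambda>x. x \<bullet> h) = normal_measure (m \<bullet> h) (C h \<bullet> h))"

definition Joint :: "'a measure \<Rightarrow> 'b measure \<Rightarrow> ('a \<times> 'b) measure set" where
  "Joint \<mu> \<nu> = {\<gamma>. prob_space \<gamma> \<and> sets \<gamma> = sets (\<mu> \<Otimes>\<^sub>M \<nu>) \<and>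
      distr \<gamma> \<mu> fst = \<mu> \<and> distr \<gamma> \<nu> snd = \<nu>}"

definition KL :: "'a measure \<Rightarrow> 'a measure \<Rightarrow> ereal" where
  "KL \<gamma> P = (if absolutely_continuous P \<gamma> \<and> integrable \<gamma> (\<lambda>z. ln (enn2real (RN_deriv P \<gamma> z)))
     then ereal (\<integral>z. ln (enn2real (RN_deriv P \<gamma> z)) \<partial>\<gamma>) else \<infinity>)"

definition OT_eps :: "real \<Rightarrow> 'h::real_normed_vector measure \<Rightarrow> 'h measure \<Rightarrow> ereal" where
  "OT_eps \<epsilon> \<mu> \<nu> = (INF \<gamma>\<in>Joint \<mu> \<nu>.
      enn2ereal (\<integral>\<^sup>+ z. ennreal ((norm (fst z - snd z))\<^sup>2) \<partial>\<gamma>) + ereal \<epsilon> * KL \<gamma> (\<mu> \<Otimes>\<^sub>M \<nu>))"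

definition S_eps :: "real \<Rightarrow> 'h::real_normed_vector measure \<Rightarrow> 'h measure \<Rightarrow> ereal" where
  "S_eps \<epsilon> \<mu> \<nu> = OT_eps \<epsilon> \<mu> \<nu> - (OT_eps \<epsilon> \<mu> \<mu> + OT_eps \<epsilon> \<nu> \<nu>) / 2"

definition psd_matrix :: "real^'n^'n \<Rightarrow> bool" where
  "psd_matrix A \<longleftrightarrow> transpose A = A \<and> (\<forall>v. 0 \<le> v \<bullet> (A *v v))"

definition matrix_sqrt :: "real^'n^'n \<Rightarrow> real^'n^'n" where
  "matrix_sqrt A = (THE R. psd_matrix R \<and> R ** R = A)"

definition centering :: "real^'n^'n" where
  "centering = mat 1 - (\<chi> i j. 1 / real CARD('n))"

definition gram :: "('x \<Rightarrow> 'x \<Rightarrow> real) \<Rightarrow> ('n \<Rightarrow> 'x) \<Rightarrow> ('n \<Rightarrow> 'x) \<Rightarrow> real^'n^'n" where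
  "gram K X Y = (\<chi> i j. K (X i) (Y j))"

text \<open>Empirical mean and covariance of Phi(X) in the feature space:
  mu = (1/m) sum_j Phi(x_j),  C = (1/m) Phi(X) J_m Phi(X)^*.\<close>
definition emp_mean :: "('x \<Rightarrow> 'h::real_inner) \<Rightarrow> ('n::finite \<Rightarrow> 'x) \<Rightarrow> 'h" where
  "emp_mean \<Phi> X = (1 / real CARD('n)) *\<^sub>R (\<Sum>j\<in>UNIV. \<Phi> (X j))"

definition emp_cov :: "('x \<Rightarrow> 'h::real_inner) \<Rightarrow> ('n::finite \<Rightarrow> 'x) \<Rightarrow> 'h \<Rightarrow> 'h" where
  "emp_cov \<Phi> X h = (1 / real CARD('n)) *\<^sub>R
     (\<Sum>i\<in>UNIV. \<Sum>j\<in>UNIV. ((centering :: real^'n^'n) $ i $ j * (\<Phi> (X j) \<bullet> h)) *\<^sub>R \<Phi> (X i))"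

end

theory Submission
  imports Defs "HOL-Real_Asymp.Real_Asymp"
begin

text \<open>If some coupling has a density with respect to \<open>\<mu> \<otimes> \<nu>\<close> of the form
  \<open>exp ((a x + b y - \<bar>x - y\<bar>\<^sup>2) / \<epsilon>)\<close>, Gibbs' inequality shows that it is optimal and that the
  optimal value is \<open>\<integral>a d\<mu> + \<integral>b d\<nu>\<close>. For the two empirical Gaussians such a coupling is explicit:
  diagonalising \<open>J K[X,Y] J K[Y,X] J\<close> yields coordinates in which both laws are standard normal and
  the cross term \<open>\<langle>x - m\<^sub>0, y - m\<^sub>1\<rangle>\<close> is almost surely diagonal, so the density is a product of
  bivariate normal density ratios, one for each positive eigenvalue.\<close>

text \<open>\<open>is_gaussian\<close> prescribes only one-dimensional marginals, and the
  covariances have finite rank in a space that may be infinite-dimensional, so Lebesgue densities of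
  the two laws are not at hand. Densities relative to the product of the two laws avoid both
  problems. Optimality is then a matter of bookkeeping: integrated against any coupling, the parts
  of the exponent that depend on x alone or on y alone are fixed by the marginals, so cost plus eps
  times the integral of the log density takes the same value for all absolutely continuous
  couplings. The constants come from matching cross terms. For correlation r the log of the
  bivariate density ratio contains r / (1 - r^2) times s t, while -|x - y|^2 / eps contributes 2
  sqrt(l) / eps times s t in a coordinate with eigenvalue l. The resulting quadratic equation for r
  has discriminant proportional to 1 + 16 l / eps^2. The empirical frames carry a factor 1 / sqrt(m)
  each, so l is an eigenvalue of P divided by m^2, which gives c = 16 / (eps^2 m^2).\<close>

section \<open>Spectral decomposition and square roots of real symmetric matrices\<close>

text \<open>A maximiser of the Rayleigh quotient on the unit sphere of \<open>S\<close> is an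
  eigenvector: otherwise moving it towards the residual \<open>f x - c x\<close> would increase the
  quotient to first order.\<close>

lemma selfadjoint_eigenvector_exists:
  fixes f :: "'a::euclidean_space \<Rightarrow> 'a"
  assumes lin: "linear f" and sym: "\<And>x y. f x \<bullet> y = x \<bullet> f y"
    and S: "subspace S" and inv: "f ` S \<subseteq> S" and ne: "S \<noteq> {0}"
  obtains x c where "x \<in> S" "norm x = 1" "f x = c *\<^sub>R x"
proof -
  interpret f: linear f by fact
  let ?K = "S \<inter> sphere 0 1"
  have "0 \<in> S" using S by (rule subspace_0)
  then obtain y where y: "y \<in> S" "y \<noteq> 0" using ne by blast
  then have "(1 / norm y) *\<^sub>R y \<in> ?K"
    using S by (simp add: subspace_scale)
  then have "?K \<noteq> {}" by blast
  moreover have "compact ?K"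
    by (simp add: S closed_Int_compact closed_subspace)
  moreover have "continuous_on ?K (\<lambda>x. x \<bullet> f x)"
    by (intro continuous_intros linear_continuous_on linear_conv_bounded_linear[THEN iffD1] lin)
  ultimately obtain x where x: "x \<in> ?K" and max: "\<And>z. z \<in> ?K \<Longrightarrow> z \<bullet> f z \<le> x \<bullet> f x"
    using continuous_attains_sup[of ?K "\<lambda>x. x \<bullet> f x"] by blast
  define c where "c = x \<bullet> f x"
  have xS: "x \<in> S" and nx: "norm x = 1" and xx: "x \<bullet> x = 1"
    using x by (auto simp: dot_square_norm)
  have bound: "z \<bullet> f z \<le> c * (z \<bullet> z)" if "z \<in> S" for z
  proof (cases "z = 0")
    case False
    then have "(1 / norm z) *\<^sub>R z \<in> ?K"
      using S that by (simp add: subspace_scale)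
    from max[OF this] False show ?thesis
      by (simp add: f.scaleR c_def dot_square_norm power2_eq_square field_simps)
  qed (simp add: f.zero)
  define w where "w = f x - c *\<^sub>R x"
  have wS: "w \<in> S"
    using xS inv S unfolding w_def by (intro subspace_diff subspace_scale) auto
  have xw: "x \<bullet> w = 0"
    by (simp add: w_def inner_diff_right xx c_def)
  have wf: "w \<bullet> f x = w \<bullet> w"
    using xw by (simp add: w_def inner_diff_right inner_commute)
  \<comment> \<open>The Rayleigh bound at \<open>x + t w\<close>. The term linear in
    \<open>t\<close> is 2 t |w|^2, which a small positive \<open>t\<close> cannot compensate unless
    \<open>w\<close> is zero.\<close>
  have ineq: "2 * t * (w \<bullet> w) + t\<^sup>2 * (w \<bullet> f w - c * (w \<bullet> w)) \<le> 0" for t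
  proof -
    have "x \<bullet> f w = w \<bullet> w" using sym[of x w] wf by (simp add: inner_commute)
    moreover have "x + t *\<^sub>R w \<in> S" using xS wS S by (simp add: subspace_add subspace_scale)
    ultimately show ?thesis using bound[of "x + t *\<^sub>R w"] xw wf
      by (simp add: f.add f.scaleR inner_add_left inner_add_right xx c_def[symmetric]
          inner_commute[of w x] power2_eq_square algebra_simps)
  qed
  have "w \<bullet> w = 0"
  proof (rule ccontr)
    assume "w \<bullet> w \<noteq> 0"
    then have pos: "w \<bullet> w > 0" by simp
    \<comment> \<open>\<open>d\<close> bounds the coefficient of t^2 in absolute value, and the
      extra summand keeps it positive. With \<open>t * d\<close> equal to |w|^2 the inequality
      becomes 2 |w|^2 <= |w|^2.\<close>
    define d where "d = \<bar>w \<bullet> f w - c * (w \<bullet> w)\<bar> + w \<bullet> w"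
    have d: "d > 0" unfolding d_def using pos by (rule add_nonneg_pos[OF abs_ge_zero])
    define t where "t = (w \<bullet> w) / d"
    have t: "t > 0" unfolding t_def using pos d by simp
    have "t * (2 * (w \<bullet> w) + t * (w \<bullet> f w - c * (w \<bullet> w))) \<le> 0"
      using ineq[of t] by (simp add: power2_eq_square algebra_simps)
    then have "2 * (w \<bullet> w) \<le> t * - (w \<bullet> f w - c * (w \<bullet> w))"
      using t by (simp add: mult_le_0_iff right_diff_distrib)
    also have "\<dots> \<le> t * d"
      using t pos abs_ge_minus_self[of "w \<bullet> f w - c * (w \<bullet> w)"]
      unfolding d_def by (intro mult_left_mono) linarith+
    also have "\<dots> = w \<bullet> w" using d by (simp add: t_def)
    finally show False using pos by simp
  qed
  then have "f x = c *\<^sub>R x" by (simp add: w_def)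
  with xS nx show thesis by (rule that)
qed

text \<open>Induction on the dimension, stated for invariant subspaces because the complement of an
  eigenvector inside \<open>S\<close> is again invariant by self-adjointness. Orthonormality
  together with the cardinality makes \<open>B\<close> a basis.\<close>

lemma selfadjoint_orthonormal_eigenbasis:
  fixes f :: "'a::euclidean_space \<Rightarrow> 'a"
  assumes lin: "linear f" and sym: "\<And>x y. f x \<bullet> y = x \<bullet> f y"
    and "subspace S" and "f ` S \<subseteq> S"
  shows "\<exists>B\<subseteq>S. pairwise orthogonal B \<and> (\<forall>x\<in>B. norm x = 1 \<and> (\<exists>c. f x = c *\<^sub>R x)) \<and> card B = dim S"
  using assms(3,4)
proof (induction "dim S" arbitrary: S)
  case 0
  then show ?case by (intro exI[of _ "{}"]) auto
next
  case (Suc n)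
  interpret f: linear f by fact
  have "S \<noteq> {0}" using Suc.hyps(2) by auto
  then obtain x c where x: "x \<in> S" "norm x = 1" and fx: "f x = c *\<^sub>R x"
    using selfadjoint_eigenvector_exists[OF lin sym Suc.prems] by blast
  have x0: "x \<noteq> 0" using x by auto
  define T where "T = {y \<in> S. x \<bullet> y = 0}"
  have T: "subspace T"
    using Suc.prems(1) unfolding T_def subspace_def by (auto simp: inner_add_right)
  have invT: "f ` T \<subseteq> T"
  proof
    fix z assume "z \<in> f ` T"
    then obtain y where y: "y \<in> T" "z = f y" by blast
    have "x \<bullet> f y = c * (x \<bullet> y)" using sym[of x y] fx by simp
    then show "z \<in> T" using y Suc.prems(2) by (auto simp: T_def)
  qed
  have "span (insert x T) = S"
  proof
    show "span (insert x T) \<subseteq> S"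
      using x Suc.prems(1) by (intro span_minimal) (auto simp: T_def)
    show "S \<subseteq> span (insert x T)"
    proof
      fix y assume y: "y \<in> S"
      have "y - (x \<bullet> y) *\<^sub>R x \<in> T"
        using x y Suc.prems(1)
        by (auto simp: T_def subspace_diff subspace_scale inner_diff_right dot_square_norm)
      then show "y \<in> span (insert x T)"
        by (auto simp: span_insert intro: span_base)
    qed
  qed
  moreover have xT: "x \<notin> span T"
    using T x0 by (simp add: span_eq_iff[THEN iffD2] T_def)
  ultimately have "dim S = Suc (dim T)"
    using dim_insert[of x T] dim_span[of "insert x T"] by simp
  then have "n = dim T" using Suc.hyps(2) by simp
  from Suc.hyps(1)[OF this T invT] obtain B where
    B: "B \<subseteq> T" "pairwise orthogonal B" "card B = dim T"
      "\<And>z. z \<in> B \<Longrightarrow> norm z = 1 \<and> (\<exists>c. f z = c *\<^sub>R z)"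
    by blast
  have finB: "finite B"
    using pairwise_orthogonal_imp_finite[OF B(2)] .
  have xB: "x \<notin> B" using B(1) xT span_base by blast
  show ?case
  proof (intro exI[of _ "insert x B"] conjI)
    show "insert x B \<subseteq> S" using B(1) x by (auto simp: T_def)
    show "pairwise orthogonal (insert x B)"
      using B(1,2) unfolding pairwise_insert T_def orthogonal_def by (auto simp: inner_commute)
    show "\<forall>z\<in>insert x B. norm z = 1 \<and> (\<exists>c. f z = c *\<^sub>R z)" using B(4) x fx by auto
    show "card (insert x B) = dim S"
      using finB xB B(3) \<open>dim S = Suc (dim T)\<close> by simp
  qed
qed

lemma inner_matrix_vector_mult:
  fixes A :: "real^'n^'m"
  shows "(A *v x) \<bullet> y = x \<bullet> (transpose A *v y)"
  by (metis dot_lmul_matrix vector_transpose_matrix)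

definition diagonal :: "('n \<Rightarrow> real) \<Rightarrow> real^'n^'n" where
  "diagonal d = (\<chi> i j. if i = j then d i else 0)"

lemma symmetric_matrix_diagonalizable:
  fixes A :: "real^'n^'n"
  assumes A: "transpose A = A"
  obtains Q l where "orthogonal_matrix Q" "A = Q ** diagonal l ** transpose Q"
proof -
  have "(A *v x) \<bullet> y = x \<bullet> (A *v y)" for x y
    by (simp add: inner_matrix_vector_mult A)
  then obtain B where B: "pairwise orthogonal B" "card B = CARD('n)"
      "\<And>x. x \<in> B \<Longrightarrow> norm x = 1 \<and> (\<exists>c. A *v x = c *\<^sub>R x)"
    using selfadjoint_orthonormal_eigenbasis[of "\<lambda>x. A *v x" UNIV] by auto
  have "finite B" using pairwise_orthogonal_imp_finite[OF B(1)] .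
  \<comment> \<open>The eigenbasis has as many elements as the index type, so it can be indexed by
    it and serve as the columns of \<open>Q\<close>.\<close>
  then obtain u where u: "bij_betw u (UNIV :: 'n set) B"
    using B(2) finite_same_card_bij[of "UNIV :: 'n set" B] by auto
  have uB: "u i \<in> B" for i using u by (auto simp: bij_betw_def)
  obtain l where l: "A *v u i = l i *\<^sub>R u i" for i using B(3)[OF uB] by metis
  have inner_u: "u i \<bullet> u j = (if i = j then 1 else 0)" for i j
  proof (cases "i = j")
    case True
    then show ?thesis using B(3)[OF uB] by (simp add: dot_square_norm)
  next
    case False
    then have "u i \<noteq> u j" using u by (auto simp: bij_betw_def inj_def)
    then show ?thesis using False B(1) uB by (auto simp: pairwise_def orthogonal_def)
  qed
  define Q :: "real^'n^'n" where "Q = (\<chi> i j. u j $ i)"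
  have "transpose Q ** Q = mat 1"
    using inner_u by (simp add: vec_eq_iff matrix_matrix_mult_def transpose_def Q_def mat_def inner_vec_def)
  then have Q: "orthogonal_matrix Q" by (simp add: orthogonal_matrix)
  have "(A ** Q) $ i $ j = (Q ** diagonal l) $ i $ j" for i j
  proof -
    have "(A ** Q) $ i $ j = (A *v u j) $ i"
      by (simp add: matrix_matrix_mult_def matrix_vector_mult_def Q_def)
    also have "\<dots> = (Q ** diagonal l) $ i $ j"
      by (simp add: l matrix_matrix_mult_def Q_def diagonal_def mult_delta_left mult_delta_right)
    finally show ?thesis .
  qed
  then have "A ** Q = Q ** diagonal l" by (simp add: vec_eq_iff)
  then have "A = Q ** diagonal l ** transpose Q"
    using Q matrix_mul_assoc[of A Q "transpose Q"] by (simp add: orthogonal_matrix_def)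
  with Q show thesis by (rule that)
qed

section \<open>Calculus of diagonal matrices\<close>

lemma diagonal_mult_diagonal: "diagonal a ** diagonal b = diagonal (\<lambda>i. a i * b i)"
  by (simp add: vec_eq_iff matrix_matrix_mult_def diagonal_def mult_delta_left mult_delta_right)

lemma transpose_diagonal [simp]: "transpose (diagonal d) = diagonal d"
  by (simp add: vec_eq_iff transpose_def diagonal_def)

lemma trace_diagonal: "trace (diagonal d) = (\<Sum>i\<in>UNIV. d i)"
  by (simp add: trace_def diagonal_def)

lemma det_diagonal_matrix: "det (diagonal d) = (\<Prod>i\<in>UNIV. d i)"
  by (subst det_diagonal) (simp_all add: diagonal_def)

lemma diagonal_add: "diagonal a + diagonal b = diagonal (\<lambda>i. a i + b i)"
  by (simp add: vec_eq_iff diagonal_def)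

lemma diagonal_scaleR: "c *\<^sub>R diagonal a = diagonal (\<lambda>i. c * a i)"
  by (simp add: vec_eq_iff diagonal_def)

lemma mat_1_eq_diagonal: "mat 1 = diagonal (\<lambda>i. 1)"
  by (simp add: vec_eq_iff diagonal_def mat_def)

lemma diagonal_mult_vector: "diagonal d *v x = (\<chi> i. d i * x $ i)"
  by (simp add: vec_eq_iff matrix_vector_mult_def diagonal_def mult_delta_left mult_delta_right)

lemma psd_diagonal: "psd_matrix (diagonal d) \<longleftrightarrow> (\<forall>i. 0 \<le> d i)"
proof
  assume *: "psd_matrix (diagonal d)"
  show "\<forall>i. 0 \<le> d i"
  proof
    fix i
    have "0 \<le> axis i 1 \<bullet> (diagonal d *v axis i 1)" using * by (simp add: psd_matrix_def)
    then show "0 \<le> d i" by (simp add: inner_axis' diagonal_mult_vector)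
  qed
next
  assume "\<forall>i. 0 \<le> d i"
  then show "psd_matrix (diagonal d)"
    by (auto simp: psd_matrix_def diagonal_mult_vector inner_vec_def mult.left_commute intro!: sum_nonneg)
qed

section \<open>Congruence and positive semidefinite square roots\<close>

lemma psd_congruence:
  fixes A :: "real^'n^'n" and B :: "real^'m^'n"
  assumes "psd_matrix A" shows "psd_matrix (transpose B ** A ** B)"
proof -
  have "v \<bullet> ((transpose B ** A ** B) *v v) = (B *v v) \<bullet> (A *v (B *v v))" for v
    unfolding inner_matrix_vector_mult[of B] by (simp only: matrix_vector_mul_assoc matrix_mul_assoc)
  then show ?thesis
    using assms by (auto simp: psd_matrix_def matrix_transpose_mul matrix_mul_assoc)
qed

text \<open>On an eigenvector u of S with eigenvalue l one has (R + l)(R - l) u = 0, and R + l is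
  injective when l > 0. Since \<open>matrix_sqrt\<close> is a definite description, every evaluation
  of it rests on this uniqueness.\<close>

lemma psd_sqrt_unique:
  fixes R S :: "real^'n^'n"
  assumes R: "psd_matrix R" and S: "psd_matrix S" and eq: "R ** R = S ** S"
  shows "R = S"
proof -
  obtain Q l where Q: "orthogonal_matrix Q" and SQ: "S = Q ** diagonal l ** transpose Q"
    using symmetric_matrix_diagonalizable S by (metis psd_matrix_def)
  have QQ: "transpose Q ** Q = mat 1" "Q ** transpose Q = mat 1"
    using Q by (simp_all add: orthogonal_matrix_def)
  have "transpose Q ** S ** Q = diagonal l"
    unfolding SQ by (simp add: matrix_mul_assoc QQ)
      (simp add: QQ flip: matrix_mul_assoc)
  then have l: "0 \<le> l i" for i using psd_congruence[OF S, of Q] by (simp add: psd_diagonal)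
  have Su: "S *v (Q *v axis i 1) = l i *\<^sub>R (Q *v axis i 1)" for i
  proof -
    have "S *v (Q *v axis i 1) = Q *v (diagonal l *v axis i 1)"
      unfolding SQ by (simp add: matrix_vector_mul_assoc QQ flip: matrix_mul_assoc)
    also have "diagonal l *v axis i 1 = l i *\<^sub>R axis i 1"
      by (auto simp: diagonal_mult_vector vec_eq_iff axis_def)
    finally show ?thesis by (simp add: matrix_vector_mult_scaleR)
  qed
  have "R *v (Q *v axis i 1) = S *v (Q *v axis i 1)" for i
  proof -
    define u where "u = Q *v axis i 1"
    have RRu: "R *v (R *v u) = (l i * l i) *\<^sub>R u"
      using eq Su[of i] by (metis matrix_vector_mul_assoc matrix_vector_mult_scaleR scaleR_scaleR u_def)
    define w where "w = R *v u - l i *\<^sub>R u"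
    have Rsym: "(R *v x) \<bullet> y = x \<bullet> (R *v y)" for x y
      using R by (simp add: inner_matrix_vector_mult psd_matrix_def)
    have "w = 0"
    proof (cases "l i = 0")
      case True
      then have "w \<bullet> w = 0" using RRu by (simp add: w_def Rsym)
      then show ?thesis by simp
    next
      case False
      \<comment> \<open>A nonzero \<open>w\<close> would be an eigenvector of the positive
        semidefinite \<open>R\<close> with the negative eigenvalue \<open>- l i\<close>.\<close>
      have "R *v w = - l i *\<^sub>R w"
        by (simp add: w_def matrix_vector_mult_diff_distrib matrix_vector_mult_scaleR RRu algebra_simps)
      then have "0 \<le> - (l i * (w \<bullet> w))" using R by (auto simp: psd_matrix_def elim!: allE[of _ w])
      then have "l i * (w \<bullet> w) \<le> 0" by simp
      moreover have "0 < l i" using l[of i] False by simp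
      ultimately have "w \<bullet> w \<le> 0" by (simp add: mult_le_0_iff)
      then show ?thesis using inner_gt_zero_iff[of w] by linarith
    qed
    then show ?thesis using Su[of i] by (simp add: w_def u_def)
  qed
  then have "(R ** Q) *v axis i 1 = (S ** Q) *v axis i 1" for i
    by (simp add: matrix_vector_mul_assoc)
  then have "R ** Q = S ** Q"
    by (simp only: matrix_vector_mult_basis) (simp add: column_def vec_eq_iff)
  then have "R ** (Q ** transpose Q) = S ** (Q ** transpose Q)" by (simp add: matrix_mul_assoc)
  then show ?thesis by (simp add: QQ)
qed

lemma matrix_sqrt_square:
  fixes R :: "real^'n^'n"
  assumes "psd_matrix R" shows "matrix_sqrt (R ** R) = R"
  unfolding matrix_sqrt_def
proof (rule the_equality)
  show "psd_matrix R \<and> R ** R = R ** R" using assms by simp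
  show "S = R" if "psd_matrix S \<and> S ** S = R ** R" for S
    using that assms by (blast intro: psd_sqrt_unique)
qed

section \<open>Spectral calculus under orthogonal conjugation\<close>

lemma conjugate_diagonal_mult:
  assumes "orthogonal_matrix Q"
  shows "(Q ** diagonal a ** transpose Q) ** (Q ** diagonal b ** transpose Q) =
    Q ** diagonal (\<lambda>i. a i * b i) ** transpose Q"
proof -
  have "(Q ** diagonal a ** transpose Q) ** (Q ** diagonal b ** transpose Q) =
      Q ** diagonal a ** (transpose Q ** Q) ** diagonal b ** transpose Q"
    by (simp only: matrix_mul_assoc)
  also have "\<dots> = Q ** (diagonal a ** diagonal b) ** transpose Q"
    using assms by (simp add: orthogonal_matrix_def matrix_mul_assoc)
  finally show ?thesis by (simp only: diagonal_mult_diagonal)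
qed

lemma trace_conjugate:
  assumes "orthogonal_matrix Q" shows "trace (Q ** A ** transpose Q) = trace (A :: real^'n^'n)"
proof -
  have "trace (Q ** A ** transpose Q) = trace (transpose Q ** (Q ** A))" by (rule trace_mul_sym)
  also have "\<dots> = trace ((transpose Q ** Q) ** A)" by (simp only: matrix_mul_assoc)
  finally show ?thesis using assms by (simp add: orthogonal_matrix_def)
qed

lemma det_conjugate:
  assumes "orthogonal_matrix Q" shows "det (Q ** A ** transpose Q) = det (A :: real^'n^'n)"
proof -
  have "det Q * det Q = 1"
    using assms det_mul[of "transpose Q" Q] by (simp add: orthogonal_matrix_def)
  then show ?thesis by (simp add: det_mul mult.commute mult.left_commute)
qed

lemma matrix_add_rdistrib: "(A + B) ** C = A ** C + B ** (C :: real^'n^'n)"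
  by (simp add: vec_eq_iff matrix_matrix_mult_def sum.distrib distrib_right)

lemma conjugate_add_id:
  assumes "orthogonal_matrix Q"
  shows "a *\<^sub>R mat 1 + c *\<^sub>R (Q ** diagonal l ** transpose Q) =
    Q ** diagonal (\<lambda>i. a + c * l i) ** transpose Q"
proof -
  have "Q ** diagonal (\<lambda>i. a + c * l i) ** transpose Q =
      Q ** (a *\<^sub>R mat 1 + c *\<^sub>R diagonal l) ** transpose Q"
    by (simp add: mat_1_eq_diagonal diagonal_add diagonal_scaleR)
  also have "\<dots> = a *\<^sub>R mat 1 + c *\<^sub>R (Q ** diagonal l ** transpose Q)"
    using assms by (simp add: matrix_add_ldistrib matrix_add_rdistrib orthogonal_matrix_def
        scalar_matrix_assoc[symmetric] matrix_scalar_ac)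
  finally show ?thesis by simp
qed

lemma matrix_sqrt_conjugate_diagonal:
  assumes Q: "orthogonal_matrix Q" and l: "\<And>i. 0 \<le> l i"
  shows "matrix_sqrt (Q ** diagonal l ** transpose Q) = Q ** diagonal (\<lambda>i. sqrt (l i)) ** transpose Q"
proof -
  have "psd_matrix (Q ** diagonal (\<lambda>i. sqrt (l i)) ** transpose Q)"
    using psd_congruence[of "diagonal (\<lambda>i. sqrt (l i))" "transpose Q"] l by (simp add: psd_diagonal)
  from matrix_sqrt_square[OF this] show ?thesis
    using l by (simp add: conjugate_diagonal_mult[OF Q])
qed

text \<open>The part of the transport cost that comes from the entropic coupling of the two
  covariances. As a function of \<open>P\<close> it serves the cross term and both self terms of the
  divergence.\<close>

definition entropic_term :: "real \<Rightarrow> real \<Rightarrow> real^'n^'n \<Rightarrow> real" where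
  "entropic_term \<epsilon> c P = - (\<epsilon>/2) * trace (- mat 1 + matrix_sqrt (mat 1 + c *\<^sub>R P))
     + (\<epsilon>/2) * ln (det ((1/2) *\<^sub>R mat 1 + (1/2) *\<^sub>R matrix_sqrt (mat 1 + c *\<^sub>R P)))"

text \<open>Trace and log-determinant depend only on the spectrum, so there is one scalar summand
  per eigenvalue, equal to 0 for a zero eigenvalue. The Gaussian computation produces this form, and
  the limits in \<open>\<epsilon>\<close> are taken in it.\<close>

lemma entropic_term_conjugate_diagonal:
  assumes Q: "orthogonal_matrix Q" and l: "\<And>i. 0 \<le> l i" and c: "0 \<le> c"
  shows "entropic_term \<epsilon> c (Q ** diagonal l ** transpose Q) =
    (\<Sum>i\<in>UNIV. - (\<epsilon>/2) * (sqrt (1 + c * l i) - 1) + (\<epsilon>/2) * ln ((1 + sqrt (1 + c * l i)) / 2))"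
proof -
  have nn: "0 \<le> 1 + c * l i" for i using l c by simp
  have R: "matrix_sqrt (mat 1 + c *\<^sub>R (Q ** diagonal l ** transpose Q)) =
      Q ** diagonal (\<lambda>i. sqrt (1 + c * l i)) ** transpose Q"
    using conjugate_add_id[OF Q, of 1 c l] matrix_sqrt_conjugate_diagonal[OF Q nn] by simp
  have 1: "- mat 1 + Q ** diagonal (\<lambda>i. sqrt (1 + c * l i)) ** transpose Q =
      Q ** diagonal (\<lambda>i. sqrt (1 + c * l i) - 1) ** transpose Q"
    using conjugate_add_id[OF Q, of "-1" 1 "\<lambda>i. sqrt (1 + c * l i)"] by simp
  have 2: "(1/2) *\<^sub>R mat 1 + (1/2) *\<^sub>R (Q ** diagonal (\<lambda>i. sqrt (1 + c * l i)) ** transpose Q) =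
      Q ** diagonal (\<lambda>i. (1 + sqrt (1 + c * l i)) / 2) ** transpose Q"
    using conjugate_add_id[OF Q, of "1/2" "1/2" "\<lambda>i. sqrt (1 + c * l i)"] by (simp add: add_divide_distrib)
  have pos: "0 < (1 + sqrt (1 + c * l i)) / 2" for i
    using nn[of i] by (simp add: add_pos_nonneg)
  have "ln (\<Prod>i\<in>UNIV. (1 + sqrt (1 + c * l i)) / 2) = (\<Sum>i\<in>UNIV. ln ((1 + sqrt (1 + c * l i)) / 2))"
    using pos by (intro ln_prod) (auto simp: less_imp_neq[symmetric] simp del: zero_less_divide_iff)
  then show ?thesis
    unfolding entropic_term_def R 1 2 trace_conjugate[OF Q] det_conjugate[OF Q]
      trace_diagonal det_diagonal_matrix
    by (simp add: sum_distrib_left sum.distrib[symmetric] algebra_simps)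
qed

section \<open>Gaussian measures\<close>

lemma prob_space_std_normal [simp]: "prob_space std_normal_distribution"
  by (rule prob_space_normal_density) simp

text \<open>An affine image of the standard normal law covers the point mass and the density case at
  once, so degenerate directions need no separate treatment afterwards.\<close>

lemma normal_measure_eq_distr:
  assumes "0 \<le> v"
  shows "normal_measure a v = distr std_normal_distribution borel (\<lambda>t. a + sqrt v * t)"
proof (cases "v = 0")
  case True
  interpret N: prob_space std_normal_distribution by simp
  have "distr std_normal_distribution borel (\<lambda>t. a) = return borel a"
  proof (rule measure_eqI)
    fix A assume "A \<in> sets (distr std_normal_distribution borel (\<lambda>t. a))"
    then have "A \<in> sets borel" by simp
    then show "emeasure (distr std_normal_distribution borel (\<lambda>t. a)) A = emeasure (return borel a) A"
      using N.emeasure_space_1 by (cases "a \<in> A") (simp_all add: emeasure_distr)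
  qed simp
  then show ?thesis using True by (simp add: normal_measure_def)
next
  case False
  then have v: "0 < sqrt v" using assms by simp
  interpret N: prob_space std_normal_distribution by simp
  have "distributed std_normal_distribution lborel (\<lambda>t. t) std_normal_density"
    by (auto simp: distributed_def intro!: measure_eqI simp: emeasure_distr)
  then have "distributed std_normal_distribution lborel (\<lambda>t. (a + sqrt v * t - a) / sqrt v) std_normal_density"
    using v by simp
  then have "distributed std_normal_distribution lborel (\<lambda>t. a + sqrt v * t) (normal_density a (sqrt v))"
    using N.normal_standard_normal_convert[OF v, of "\<lambda>t. a + sqrt v * t" a] by simp
  then have "distr std_normal_distribution lborel (\<lambda>t. a + sqrt v * t) = density lborel (normal_density a (sqrt v))"
    by (simp add: distributed_def)
  moreover have "distr std_normal_distribution borel (\<lambda>t. a + sqrt v * t) =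
      distr std_normal_distribution lborel (\<lambda>t. a + sqrt v * t)"
    by (rule distr_cong) auto
  ultimately show ?thesis using False by (simp add: normal_measure_def)
qed

lemma borel_measurable_gaussian:
  fixes f :: "'h::real_inner \<Rightarrow> 'b::topological_space"
  assumes "f \<in> borel_measurable borel" and "is_gaussian M m C"
  shows "f \<in> borel_measurable M"
  using assms measurable_cong_sets[of M borel borel borel] by (auto simp: is_gaussian_def)

lemma gaussian_distr_centered:
  fixes h :: "'h::{real_inner, second_countable_topology}"
  assumes G: "is_gaussian M m C" and nonneg: "0 \<le> C h \<bullet> h"
  shows "distr M borel (\<lambda>x. (x - m) \<bullet> h) =
    distr std_normal_distribution borel (\<lambda>t. sqrt (C h \<bullet> h) * t)"
proof -
  have [measurable]: "(\<lambda>x. x \<bullet> h) \<in> borel_measurable M"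
    by (rule borel_measurable_gaussian[OF _ G]) measurable
  have "distr M borel (\<lambda>x. (x - m) \<bullet> h) = distr (distr M borel (\<lambda>x. x \<bullet> h)) borel (\<lambda>t. t - m \<bullet> h)"
    by (subst distr_distr) (auto simp: comp_def inner_diff_left)
  also have "distr M borel (\<lambda>x. x \<bullet> h) =
      distr std_normal_distribution borel (\<lambda>t. m \<bullet> h + sqrt (C h \<bullet> h) * t)"
    using G normal_measure_eq_distr[OF nonneg] by (auto simp: is_gaussian_def)
  also have "distr \<dots> borel (\<lambda>t. t - m \<bullet> h) = distr std_normal_distribution borel (\<lambda>t. sqrt (C h \<bullet> h) * t)"
    by (subst distr_distr) (auto simp: comp_def)
  finally show ?thesis .
qed

lemma
  fixes f :: "real \<Rightarrow> 'b::{banach, second_countable_topology}"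
    and h :: "'h::{real_inner, second_countable_topology}"
  assumes G: "is_gaussian M m C" and nonneg: "0 \<le> C h \<bullet> h" and f [measurable]: "f \<in> borel_measurable borel"
  shows gaussian_integral_centered: "(\<integral>x. f ((x - m) \<bullet> h) \<partial>M) =
      (\<integral>t. f (sqrt (C h \<bullet> h) * t) \<partial>std_normal_distribution)"
    and gaussian_integrable_centered: "integrable M (\<lambda>x. f ((x - m) \<bullet> h)) \<longleftrightarrow>
      integrable std_normal_distribution (\<lambda>t. f (sqrt (C h \<bullet> h) * t))"
proof -
  have [measurable]: "(\<lambda>x. (x - m) \<bullet> h) \<in> borel_measurable M"
    by (rule borel_measurable_gaussian[OF _ G]) measurable
  show "(\<integral>x. f ((x - m) \<bullet> h) \<partial>M) = (\<integral>t. f (sqrt (C h \<bullet> h) * t) \<partial>std_normal_distribution)"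
    using gaussian_distr_centered[OF G, of h] nonneg
      integral_distr[of "\<lambda>x. (x - m) \<bullet> h" M borel f]
      integral_distr[of "\<lambda>t. sqrt (C h \<bullet> h) * t" std_normal_distribution borel f]
    by simp
  show "integrable M (\<lambda>x. f ((x - m) \<bullet> h)) \<longleftrightarrow>
      integrable std_normal_distribution (\<lambda>t. f (sqrt (C h \<bullet> h) * t))"
    using gaussian_distr_centered[OF G, of h] nonneg
      integrable_distr_eq[of "\<lambda>x. (x - m) \<bullet> h" M borel f]
      integrable_distr_eq[of "\<lambda>t. sqrt (C h \<bullet> h) * t" std_normal_distribution borel f]
    by simp
qed

lemma std_normal_second_moment:
  "integrable std_normal_distribution (\<lambda>t. t\<^sup>2)" "(\<integral>t. t\<^sup>2 \<partial>std_normal_distribution) = 1"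
  using integrable_std_normal_distribution_moment[of 2] std_normal_distribution_even_moments(1)[of 1]
  by (simp_all add: fact_numeral)

lemma std_normal_first_moment:
  "integrable std_normal_distribution (\<lambda>t. t)" "(\<integral>t. t \<partial>std_normal_distribution) = 0"
  using integrable_std_normal_distribution_moment[of 1] integral_std_normal_distribution_moment_odd[of 1]
  by simp_all

lemma
  fixes h :: "'h::{real_inner, second_countable_topology}"
  assumes G: "is_gaussian M m C" and nonneg: "0 \<le> C h \<bullet> h"
  shows gaussian_first_moment: "integrable M (\<lambda>x. (x - m) \<bullet> h)" "(\<integral>x. (x - m) \<bullet> h \<partial>M) = 0"
    and gaussian_second_moment: "integrable M (\<lambda>x. ((x - m) \<bullet> h)\<^sup>2)"
      "(\<integral>x. ((x - m) \<bullet> h)\<^sup>2 \<partial>M) = C h \<bullet> h"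
proof -
  show "integrable M (\<lambda>x. (x - m) \<bullet> h)"
    by (subst gaussian_integrable_centered[OF G nonneg, of "\<lambda>t. t"])
      (auto intro: integrable_mult_right std_normal_first_moment)
  show "(\<integral>x. (x - m) \<bullet> h \<partial>M) = 0"
    by (subst gaussian_integral_centered[OF G nonneg, of "\<lambda>t. t"])
      (simp_all add: std_normal_first_moment)
  show "integrable M (\<lambda>x. ((x - m) \<bullet> h)\<^sup>2)"
    by (subst gaussian_integrable_centered[OF G nonneg, of "\<lambda>t. t\<^sup>2"])
      (auto simp: power_mult_distrib intro: integrable_mult_right std_normal_second_moment)
  show "(\<integral>x. ((x - m) \<bullet> h)\<^sup>2 \<partial>M) = C h \<bullet> h"
    by (subst gaussian_integral_centered[OF G nonneg, of "\<lambda>t. t\<^sup>2"])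
      (simp_all add: power_mult_distrib nonneg std_normal_second_moment)
qed

text \<open>A vanishing second moment forces the centred functional to vanish almost surely.\<close>

lemma gaussian_AE_orthogonal:
  fixes h :: "'h::{real_inner, second_countable_topology}"
  assumes G: "is_gaussian M m C" and zero: "C h \<bullet> h = 0"
  shows "AE x in M. (x - m) \<bullet> h = 0"
  using gaussian_second_moment[OF G, of h] zero
    integral_nonneg_eq_0_iff_AE[of M "\<lambda>x. ((x - m) \<bullet> h)\<^sup>2"] by auto

lemma gaussian_char:
  fixes h :: "'h::{real_inner, second_countable_topology}"
  assumes G: "is_gaussian M m C" and nonneg: "0 \<le> C h \<bullet> h"
  shows "(\<integral>x. iexp ((x - m) \<bullet> h) \<partial>M) = complex_of_real (exp (- (C h \<bullet> h) / 2))"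
proof -
  have "(\<integral>x. iexp ((x - m) \<bullet> h) \<partial>M) = char std_normal_distribution (sqrt (C h \<bullet> h))"
    unfolding char_def by (rule gaussian_integral_centered[OF G nonneg]) measurable
  then show ?thesis using nonneg by (simp add: char_std_normal_distribution)
qed

section \<open>Finite-rank covariances\<close>

text \<open>A finite-rank covariance as the sum of the rank-one operators of a frame. The frame need
  be neither orthogonal nor independent, which leaves the freedom to rotate it.\<close>

definition frame_op :: "('i::finite \<Rightarrow> 'h::real_inner) \<Rightarrow> 'h \<Rightarrow> 'h" where
  "frame_op a h = (\<Sum>i\<in>UNIV. (a i \<bullet> h) *\<^sub>R a i)"

lemma frame_op_inner: "frame_op a h \<bullet> k = (\<Sum>i\<in>UNIV. (a i \<bullet> h) * (a i \<bullet> k))"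
  by (simp add: frame_op_def inner_sum_left)

lemma frame_op_inner_self: "frame_op a h \<bullet> h = (\<Sum>i\<in>UNIV. (a i \<bullet> h)\<^sup>2)"
  by (simp add: frame_op_inner power2_eq_square)

lemma frame_op_nonneg: "0 \<le> frame_op a h \<bullet> h"
  by (simp add: frame_op_inner_self sum_nonneg)

text \<open>Gram-Schmidt, followed by discarding the zero vector and normalising.\<close>

lemma orthonormal_basis_span:
  fixes A :: "'h::real_inner set"
  assumes "finite A"
  obtains E where "finite E" "span E = span A"
    "\<And>e f. e \<in> E \<Longrightarrow> f \<in> E \<Longrightarrow> e \<bullet> f = (if e = f then 1 else 0)"
proof -
  obtain B where B: "finite B" "span B = span A" "pairwise orthogonal B"
    using basis_orthogonal[OF assms] by blast
  define E where "E = (\<lambda>b. b /\<^sub>R norm b) ` (B - {0})"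
  have "span E \<subseteq> span B"
    unfolding E_def by (intro span_minimal) (auto intro: span_scale span_base)
  moreover have "b \<in> span E" if "b \<in> B" for b
  proof (cases "b = 0")
    case False
    then have "b = norm b *\<^sub>R (b /\<^sub>R norm b)" by simp
    moreover have "b /\<^sub>R norm b \<in> E" using that False by (auto simp: E_def)
    ultimately show ?thesis by (metis span_base span_scale)
  qed (simp add: span_zero)
  then have "span B \<subseteq> span E" by (intro span_minimal) auto
  moreover have "e \<bullet> f = (if e = f then 1 else 0)" if "e \<in> E" "f \<in> E" for e f
  proof -
    obtain b c where b: "b \<in> B" "b \<noteq> 0" "e = b /\<^sub>R norm b" and c: "c \<in> B" "c \<noteq> 0" "f = c /\<^sub>R norm c"
      using that \<open>e \<in> E\<close> \<open>f \<in> E\<close> unfolding E_def by blast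
    show ?thesis
    proof (cases "b = c")
      case True
      then show ?thesis using b c by (simp add: dot_square_norm power2_eq_square)
    next
      case False
      then have "b \<bullet> c = 0" using B(3) b c by (auto simp: pairwise_def orthogonal_def)
      then have ef: "e \<bullet> f = 0" using b c by simp
      moreover have "e \<bullet> e \<noteq> 0" using b by simp
      ultimately show ?thesis by auto
    qed
  qed
  ultimately show thesis using that[of E] B by (auto simp: E_def)
qed

lemma span_orthonormal_expansion:
  fixes E :: "'h::real_inner set"
  assumes "finite E" and "x \<in> span E"
    and orth: "\<And>e f. e \<in> E \<Longrightarrow> f \<in> E \<Longrightarrow> e \<bullet> f = (if e = f then 1 else 0)"
  shows "(\<Sum>e\<in>E. (x \<bullet> e) *\<^sub>R e) = x"
proof -
  obtain u where x: "x = (\<Sum>v\<in>E. u v *\<^sub>R v)"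
    using assms(2) span_finite[OF assms(1)] by auto
  have "x \<bullet> e = u e" if "e \<in> E" for e
  proof -
    have "x \<bullet> e = (\<Sum>v\<in>E. if v = e then u v else 0)"
      unfolding x inner_sum_left using orth that by (intro sum.cong) auto
    then show ?thesis using that assms(1) by simp
  qed
  then show ?thesis by (simp add: x)
qed

lemma norm_orthonormal_expansion:
  fixes E :: "'h::real_inner set"
  assumes "finite E" and "x \<in> span E"
    and orth: "\<And>e f. e \<in> E \<Longrightarrow> f \<in> E \<Longrightarrow> e \<bullet> f = (if e = f then 1 else 0)"
  shows "(norm x)\<^sup>2 = (\<Sum>e\<in>E. (x \<bullet> e)\<^sup>2)"
proof -
  have "(norm x)\<^sup>2 = x \<bullet> (\<Sum>e\<in>E. (x \<bullet> e) *\<^sub>R e)"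
    using span_orthonormal_expansion[OF assms] by (simp add: dot_square_norm)
  then show ?thesis by (simp add: inner_sum_right power2_eq_square)
qed

text \<open>The closed subspace orthogonal to the frame is tested against a countable dense set of
  directions, each of which is almost surely orthogonal to the centred variable.\<close>

lemma gaussian_AE_in_span:
  fixes a :: "'i::finite \<Rightarrow> 'h::{real_inner, second_countable_topology}"
  assumes G: "is_gaussian M m (frame_op a)"
  shows "AE x in M. x - m \<in> span (range a)"
proof -
  obtain E where E: "finite E" "span E = span (range a)"
    and orth: "\<And>e f. e \<in> E \<Longrightarrow> f \<in> E \<Longrightarrow> e \<bullet> f = (if e = f then 1 else 0)"
    using orthonormal_basis_span[of "range a"] by auto
  \<comment> \<open>The orthogonal projection onto the span of the frame. For each \<open>d\<close>
    the vector \<open>d - pr d\<close> is orthogonal to the frame, so its variance is zero.\<close>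
  define pr where "pr x = (\<Sum>e\<in>E. (x \<bullet> e) *\<^sub>R e)" for x :: 'h
  have pr_span: "pr x \<in> span (range a)" for x
    unfolding pr_def E(2)[symmetric] by (intro span_sum span_scale span_base)
  have pr_adj: "pr x \<bullet> y = x \<bullet> pr y" for x y
    by (simp add: pr_def inner_sum_left inner_sum_right inner_commute mult.commute)
  have pr_id: "pr x = x" if "x \<in> span (range a)" for x
    unfolding pr_def using that E span_orthonormal_expansion orth by metis
  obtain D :: "'h set" where D: "countable D" "\<And>X. open X \<Longrightarrow> X \<noteq> {} \<Longrightarrow> \<exists>d\<in>D. d \<in> X"
    using countable_dense_exists by blast
  have "AE x in M. \<forall>d\<in>D. (x - m) \<bullet> (d - pr d) = 0"
  proof (rule AE_ball_countable'[OF _ D(1)])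
    fix d
    have "a i \<bullet> (d - pr d) = 0" for i
      using pr_adj[of "a i" d] pr_id[of "a i"] by (simp add: inner_diff_right span_base)
    then show "AE x in M. (x - m) \<bullet> (d - pr d) = 0"
      by (intro gaussian_AE_orthogonal[OF G]) (simp add: frame_op_inner_self)
  qed
  then show ?thesis
  proof eventually_elim
    case (elim x)
    define r where "r = (x - m) - pr (x - m)"
    have r: "r \<bullet> d = 0" if "d \<in> D" for d
      using elim that pr_adj[of "x - m" d] by (simp add: r_def inner_diff_left inner_diff_right)
    have "r = 0"
    \<comment> \<open>A nonzero \<open>r\<close> would define a nonempty open half-space, which has
      to meet the dense set \<open>D\<close>.\<close>
    proof (rule ccontr)
      assume "r \<noteq> 0"
      then have "r \<in> {y. 0 < r \<bullet> y}" by simp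
      moreover have "open {y. 0 < r \<bullet> y}"
        by (intro open_Collect_less continuous_intros)
      ultimately obtain d where "d \<in> D" "0 < r \<bullet> d" using D(2)[of "{y. 0 < r \<bullet> y}"] by blast
      with r show False by simp
    qed
    then have "x - m = pr (x - m)" by (simp add: r_def)
    then show ?case using pr_span by metis
  qed
qed

text \<open>Almost surely the centred variable lies in a finite-dimensional span. Parseval for
  \<open>x - m\<close> turns the squared norm into coordinate variances, and Parseval for each
  \<open>a i\<close> collects these into the trace of the covariance.\<close>

lemma
  fixes a :: "'i::finite \<Rightarrow> 'h::{real_inner, second_countable_topology}"
  assumes G: "is_gaussian M m (frame_op a)"
  shows gaussian_norm_sq_integrable: "integrable M (\<lambda>x. (norm (x - m))\<^sup>2)"
    and gaussian_norm_sq_integral: "(\<integral>x. (norm (x - m))\<^sup>2 \<partial>M) = (\<Sum>i\<in>UNIV. (norm (a i))\<^sup>2)"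
proof -
  obtain E where E: "finite E" "span E = span (range a)"
    and orth: "\<And>e f. e \<in> E \<Longrightarrow> f \<in> E \<Longrightarrow> e \<bullet> f = (if e = f then 1 else 0)"
    using orthonormal_basis_span[of "range a"] by auto
  have [measurable]: "(\<lambda>x. (norm (x - m))\<^sup>2) \<in> borel_measurable M"
    "(\<lambda>x. (\<Sum>e\<in>E. ((x - m) \<bullet> e)\<^sup>2)) \<in> borel_measurable M"
    by (rule borel_measurable_gaussian[OF _ G], measurable)+
  have ae: "AE x in M. (norm (x - m))\<^sup>2 = (\<Sum>e\<in>E. ((x - m) \<bullet> e)\<^sup>2)"
    using gaussian_AE_in_span[OF G]
    by eventually_elim (use E orth norm_orthonormal_expansion in metis)
  show "integrable M (\<lambda>x. (norm (x - m))\<^sup>2)"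
    by (subst integrable_cong_AE[OF _ _ ae])
      (auto intro!: Bochner_Integration.integrable_sum gaussian_second_moment(1)[OF G frame_op_nonneg])
  have "(\<integral>x. (norm (x - m))\<^sup>2 \<partial>M) = (\<Sum>e\<in>E. frame_op a e \<bullet> e)"
    by (subst integral_cong_AE[OF _ _ ae])
      (auto simp: Bochner_Integration.integral_sum gaussian_second_moment[OF G frame_op_nonneg])
  also have "\<dots> = (\<Sum>i\<in>UNIV. \<Sum>e\<in>E. (a i \<bullet> e)\<^sup>2)"
    by (simp only: frame_op_inner_self sum.swap[of _ _ E])
  also have "\<dots> = (\<Sum>i\<in>UNIV. (norm (a i))\<^sup>2)"
  proof (rule sum.cong[OF refl])
    fix i
    have "a i \<in> span E" using E(2) by (simp add: span_base)
    from norm_orthonormal_expansion[OF E(1) this orth]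
    show "(\<Sum>e\<in>E. (a i \<bullet> e)\<^sup>2) = (norm (a i))\<^sup>2" by simp
  qed
  finally show "(\<integral>x. (norm (x - m))\<^sup>2 \<partial>M) = (\<Sum>i\<in>UNIV. (norm (a i))\<^sup>2)" .
qed

section \<open>Products of bivariate normal density ratios\<close>

text \<open>The characteristic function of the standard normal law read from right to left: a
  Gaussian factor is an average of characters, hence linear in \<open>u\<close> inside the exponent
  (Hubbard-Stratonovich).\<close>

lemma exp_square_eq_iexp_integral:
  assumes "0 \<le> \<alpha>"
  shows "complex_of_real (exp (- \<alpha> * u\<^sup>2)) = (\<integral>z. iexp (sqrt (2 * \<alpha>) * z * u) \<partial>std_normal_distribution)"
proof -
  have "(\<integral>z. iexp (sqrt (2 * \<alpha>) * z * u) \<partial>std_normal_distribution) =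
      char std_normal_distribution (sqrt (2 * \<alpha>) * u)"
    by (simp add: char_def mult_ac)
  then show ?thesis
    using assms by (simp add: char_std_normal_distribution power_mult_distrib)
qed

text \<open>Trades one Gaussian factor in \<open>Y\<close> for a character in \<open>Y\<close> under
  an outer normal average. Boundedness of \<open>F\<close> on a probability space is what licenses
  Fubini.\<close>

lemma integral_mult_exp_square:
  fixes Y :: "'a \<Rightarrow> real" and F :: "'a \<Rightarrow> complex"
  assumes M: "prob_space M" and F [measurable]: "F \<in> borel_measurable M" and bound: "\<And>x. norm (F x) \<le> 1"
    and Y [measurable]: "Y \<in> borel_measurable M" and \<alpha>: "0 \<le> \<alpha>"
  shows "(\<integral>x. F x * exp (- \<alpha> * (Y x - c)\<^sup>2) \<partial>M) =
    (\<integral>z. iexp (- (sqrt (2 * \<alpha>) * z * c)) * (\<integral>x. F x * iexp (sqrt (2 * \<alpha>) * z * Y x) \<partial>M)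
      \<partial>std_normal_distribution)"
proof -
  interpret M: prob_space M by fact
  interpret N: prob_space std_normal_distribution by simp
  interpret MN: pair_prob_space M std_normal_distribution ..
  let ?f = "\<lambda>x z. F x * iexp (sqrt (2 * \<alpha>) * z * (Y x - c))"
  have int: "integrable (M \<Otimes>\<^sub>M std_normal_distribution) (\<lambda>(x, z). ?f x z)"
  proof (rule MN.P.integrable_const_bound)
    show "AE p in M \<Otimes>\<^sub>M std_normal_distribution. norm (case p of (x, z) \<Rightarrow> ?f x z) \<le> 1"
      using bound by (auto simp: norm_mult)
    show "(\<lambda>(x, z). ?f x z) \<in> borel_measurable (M \<Otimes>\<^sub>M std_normal_distribution)"
      by measurable
  qed
  have "(\<integral>x. F x * exp (- \<alpha> * (Y x - c)\<^sup>2) \<partial>M) = (\<integral>x. \<integral>z. ?f x z \<partial>std_normal_distribution \<partial>M)"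
    using exp_square_eq_iexp_integral[OF \<alpha>] by simp
  also have "\<dots> = (\<integral>z. \<integral>x. ?f x z \<partial>M \<partial>std_normal_distribution)"
    using MN.Fubini_integral[OF int] by simp
  also have "\<dots> = (\<integral>z. \<integral>x. iexp (- (sqrt (2 * \<alpha>) * z * c)) * (F x * iexp (sqrt (2 * \<alpha>) * z * Y x)) \<partial>M
      \<partial>std_normal_distribution)"
    by (intro Bochner_Integration.integral_cong refl) (simp add: algebra_simps flip: exp_add)
  finally show ?thesis by simp
qed

text \<open>Writing each Gaussian factor as an average of characters reduces everything to the
  characteristic function of a single linear functional, so that no uniqueness theorem for
  multivariate characteristic functions is needed.\<close>

lemma gaussian_integral_prod_exp_square_char:
  fixes h :: "'i \<Rightarrow> 'h::{real_inner, second_countable_topology}"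
  assumes G: "is_gaussian M m C" and "finite J"
    and C: "\<And>w. C (\<Sum>i\<in>J. w i *\<^sub>R h i) \<bullet> (\<Sum>i\<in>J. w i *\<^sub>R h i) = (\<Sum>i\<in>J. (w i)\<^sup>2)"
    and \<alpha>: "\<And>i. i \<in> J \<Longrightarrow> 0 \<le> \<alpha> i" and "S \<subseteq> J"
  shows "(\<integral>x. (\<Prod>i\<in>S. complex_of_real (exp (- \<alpha> i * ((x - m) \<bullet> h i - c i)\<^sup>2)))
        * iexp (\<Sum>j\<in>J-S. w j * ((x - m) \<bullet> h j)) \<partial>M) =
    (\<Prod>i\<in>S. complex_of_real (\<integral>t. exp (- \<alpha> i * (t - c i)\<^sup>2) \<partial>std_normal_distribution))
      * complex_of_real (exp (- (\<Sum>j\<in>J-S. (w j)\<^sup>2) / 2))"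
proof -
  have M: "prob_space M" using G by (simp add: is_gaussian_def)
  interpret N: prob_space std_normal_distribution by simp
  have meas [measurable]: "(\<lambda>x. (x - m) \<bullet> h i) \<in> borel_measurable M" for i
    by (rule borel_measurable_gaussian[OF _ G]) measurable
  have "finite S" using \<open>S \<subseteq> J\<close> \<open>finite J\<close> by (rule finite_subset)
  then show ?thesis using \<open>S \<subseteq> J\<close>
  proof (induction S arbitrary: w rule: finite_induct)
    case empty
    have "(\<Sum>j\<in>J. w j * ((x - m) \<bullet> h j)) = (x - m) \<bullet> (\<Sum>j\<in>J. w j *\<^sub>R h j)" for x
      by (simp add: inner_sum_right)
    then show ?case
      using gaussian_char[OF G, of "\<Sum>j\<in>J. w j *\<^sub>R h j"] C[of w] by (simp add: sum_nonneg)
  next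
    case (insert k S)
    let ?s = "sqrt (2 * \<alpha> k)"
    let ?P = "\<Prod>i\<in>S. complex_of_real (\<integral>t. exp (- \<alpha> i * (t - c i)\<^sup>2) \<partial>std_normal_distribution)"
    let ?E = "complex_of_real (exp (- (\<Sum>j\<in>J-insert k S. (w j)\<^sup>2) / 2))"
    define F where "F x = (\<Prod>i\<in>S. complex_of_real (exp (- \<alpha> i * ((x - m) \<bullet> h i - c i)\<^sup>2)))
        * iexp (\<Sum>j\<in>J-insert k S. w j * ((x - m) \<bullet> h j))" for x
    have k: "k \<in> J" "0 \<le> \<alpha> k" and SJ: "S \<subseteq> J" using insert.prems \<alpha> by auto
    have Jk: "J - S = insert k (J - insert k S)" using k insert.hyps by auto
    have fin: "finite (J - insert k S)" using \<open>finite J\<close> by simp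
    have [measurable]: "F \<in> borel_measurable M" unfolding F_def by measurable
    have "norm (F x) \<le> 1" for x
    proof -
      have "norm (F x) = (\<Prod>i\<in>S. exp (- \<alpha> i * ((x - m) \<bullet> h i - c i)\<^sup>2))"
        by (simp add: F_def norm_mult prod_norm[symmetric])
      also have "\<dots> \<le> 1"
        using \<alpha> SJ by (intro prod_le_1) auto
      finally show ?thesis .
    qed
    note HS = integral_mult_exp_square[OF M \<open>F \<in> borel_measurable M\<close> this meas[of k] k(2)]
    have inner: "(\<integral>x. F x * iexp (?s * z * ((x - m) \<bullet> h k)) \<partial>M) =
        ?P * ?E * complex_of_real (exp (- \<alpha> k * z\<^sup>2))" for z
    proof -
      \<comment> \<open>The character created by linearising factor \<open>k\<close> joins the
        remaining ones as a new weight on \<open>h k\<close>. This is why the weights are arbitrary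
        in the induction and why characters are carried on \<open>J - S\<close>.\<close>
      let ?w = "w(k := ?s * z)"
      have lin: "(\<Sum>j\<in>J-S. ?w j * ((x - m) \<bullet> h j)) =
          (\<Sum>j\<in>J-insert k S. w j * ((x - m) \<bullet> h j)) + ?s * z * ((x - m) \<bullet> h k)" for x
        using fin unfolding Jk by (simp add: sum.insert)
      have quad: "(\<Sum>j\<in>J-S. (?w j)\<^sup>2) = (\<Sum>j\<in>J-insert k S. (w j)\<^sup>2) + 2 * \<alpha> k * z\<^sup>2"
        using fin k unfolding Jk by (simp add: sum.insert power_mult_distrib)
      have "(\<integral>x. F x * iexp (?s * z * ((x - m) \<bullet> h k)) \<partial>M) =
          (\<integral>x. (\<Prod>i\<in>S. complex_of_real (exp (- \<alpha> i * ((x - m) \<bullet> h i - c i)\<^sup>2)))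
            * iexp (\<Sum>j\<in>J-S. ?w j * ((x - m) \<bullet> h j)) \<partial>M)"
        unfolding lin F_def by (simp add: exp_add distrib_left mult.assoc)
      also have "\<dots> = ?P * complex_of_real (exp (- (\<Sum>j\<in>J-S. (?w j)\<^sup>2) / 2))"
        by (rule insert.IH[OF SJ])
      also have "complex_of_real (exp (- (\<Sum>j\<in>J-S. (?w j)\<^sup>2) / 2)) =
          ?E * complex_of_real (exp (- \<alpha> k * z\<^sup>2))"
        unfolding quad of_real_mult[symmetric] exp_add[symmetric] by (simp add: field_simps)
      finally show ?thesis by (simp add: mult.assoc)
    qed
    \<comment> \<open>The same linearisation for a single standard normal variable with
      \<open>F\<close> constantly 1, used to reassemble the outer average into the one-dimensional
      factor.\<close>
    have one_dim: "complex_of_real (\<integral>t. exp (- \<alpha> k * (t - c k)\<^sup>2) \<partial>std_normal_distribution) =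
        (\<integral>z. iexp (- (?s * z * c k)) * complex_of_real (exp (- \<alpha> k * z\<^sup>2)) \<partial>std_normal_distribution)"
      using integral_mult_exp_square[OF N.prob_space_axioms, of "\<lambda>t. 1" "\<lambda>t. t" "\<alpha> k" "c k"] k(2)
        exp_square_eq_iexp_integral[OF k(2)]
      by (simp add: mult_ac flip: integral_complex_of_real)
    have "(\<integral>x. (\<Prod>i\<in>insert k S. complex_of_real (exp (- \<alpha> i * ((x - m) \<bullet> h i - c i)\<^sup>2)))
        * iexp (\<Sum>j\<in>J-insert k S. w j * ((x - m) \<bullet> h j)) \<partial>M) =
        (\<integral>x. F x * exp (- \<alpha> k * ((x - m) \<bullet> h k - c k)\<^sup>2) \<partial>M)"
      using insert.hyps by (simp add: F_def mult_ac)
    also have "\<dots> = (\<integral>z. (?P * ?E) * (iexp (- (?s * z * c k)) * complex_of_real (exp (- \<alpha> k * z\<^sup>2)))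
        \<partial>std_normal_distribution)"
      unfolding HS inner by (simp only: mult_ac)
    also have "\<dots> = (?P * ?E) * complex_of_real (\<integral>t. exp (- \<alpha> k * (t - c k)\<^sup>2) \<partial>std_normal_distribution)"
      unfolding one_dim by (rule integral_mult_right_zero)
    finally show ?case using insert.hyps by (simp add: mult_ac)
  qed
qed

lemma gaussian_integral_prod_exp_square:
  fixes h :: "'i \<Rightarrow> 'h::{real_inner, second_countable_topology}"
  assumes G: "is_gaussian M m C" and "finite J"
    and "\<And>w. C (\<Sum>i\<in>J. w i *\<^sub>R h i) \<bullet> (\<Sum>i\<in>J. w i *\<^sub>R h i) = (\<Sum>i\<in>J. (w i)\<^sup>2)"
    and "\<And>i. i \<in> J \<Longrightarrow> 0 \<le> \<alpha> i"
  shows "(\<integral>x. (\<Prod>i\<in>J. exp (- \<alpha> i * ((x - m) \<bullet> h i - c i)\<^sup>2)) \<partial>M) =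
    (\<Prod>i\<in>J. \<integral>t. exp (- \<alpha> i * (t - c i)\<^sup>2) \<partial>std_normal_distribution)"
proof -
  have "(\<integral>x. (\<Prod>i\<in>J. complex_of_real (exp (- \<alpha> i * ((x - m) \<bullet> h i - c i)\<^sup>2))) \<partial>M) =
      (\<Prod>i\<in>J. complex_of_real (\<integral>t. exp (- \<alpha> i * (t - c i)\<^sup>2) \<partial>std_normal_distribution))"
    using gaussian_integral_prod_exp_square_char[of M m C J h \<alpha> J c "\<lambda>_. 0", OF assms order.refl]
    by (simp flip: integral_complex_of_real)
  then have "complex_of_real (\<integral>x. (\<Prod>i\<in>J. exp (- \<alpha> i * ((x - m) \<bullet> h i - c i)\<^sup>2)) \<partial>M) =
      complex_of_real (\<Prod>i\<in>J. \<integral>t. exp (- \<alpha> i * (t - c i)\<^sup>2) \<partial>std_normal_distribution)"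
    by (simp only: of_real_prod[symmetric] integral_complex_of_real)
  then show ?thesis by (simp only: of_real_eq_iff)
qed

text \<open>The ratio of the density of the centred bivariate normal law with unit variances and
  correlation \<open>r\<close> to the product of its marginal densities.\<close>

definition mehler :: "real \<Rightarrow> real \<Rightarrow> real \<Rightarrow> real" where
  "mehler r s t = exp (- (r\<^sup>2 * s\<^sup>2 + r\<^sup>2 * t\<^sup>2 - 2 * r * s * t) / (2 * (1 - r\<^sup>2))) / sqrt (1 - r\<^sup>2)"

lemma mehler_commute: "mehler r s t = mehler r t s"
  by (simp add: mehler_def algebra_simps)

lemma mehler_pos: "0 < r \<Longrightarrow> r < 1 \<Longrightarrow> 0 < mehler r s t"
  by (simp add: mehler_def power_less_one_iff)

lemma ln_mehler:
  assumes "0 < r" "r < 1"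
  shows "ln (mehler r s t) = - (r\<^sup>2 / (2 * (1 - r\<^sup>2))) * (s\<^sup>2 + t\<^sup>2) + r / (1 - r\<^sup>2) * s * t - ln (1 - r\<^sup>2) / 2"
proof -
  have r: "0 < 1 - r\<^sup>2" using assms by (simp add: power_less_one_iff)
  have "- (r\<^sup>2 * s\<^sup>2 + r\<^sup>2 * t\<^sup>2 - 2 * r * s * t) / (2 * D) =
      - (r\<^sup>2 / (2 * D)) * (s\<^sup>2 + t\<^sup>2) + r / D * s * t" if "D \<noteq> 0" for D
    using that by (simp add: field_simps)
  from this[of "1 - r\<^sup>2"] r show ?thesis
    unfolding mehler_def by (subst ln_div) (simp_all add: ln_sqrt)
qed

text \<open>Completing the square in \<open>t\<close> brings the ratio to a constant times a shifted
  Gaussian factor, the shape that \<open>gaussian_integral_prod_exp_square\<close>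
  evaluates.\<close>

lemma mehler_eq_exp_square:
  assumes "0 < r" "r < 1"
  shows "mehler r s t = exp (s\<^sup>2 / 2) / sqrt (1 - r\<^sup>2) * exp (- (r\<^sup>2 / (2 * (1 - r\<^sup>2))) * (t - s / r)\<^sup>2)"
proof -
  have "1 - r\<^sup>2 \<noteq> 0" using power_less_one_iff[of r 2] assms by simp
  then have "- (r\<^sup>2 * s\<^sup>2 + r\<^sup>2 * t\<^sup>2 - 2 * r * s * t) / (2 * (1 - r\<^sup>2)) =
      s\<^sup>2 / 2 + - (r\<^sup>2 / (2 * (1 - r\<^sup>2))) * (t - s / r)\<^sup>2"
    using assms by (simp add: divide_simps power2_eq_square) (simp add: algebra_simps)
  then show ?thesis unfolding mehler_def by (simp only: exp_add) simp
qed

text \<open>Multiplied by the standard normal density, the ratio is the conditional density of the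
  second variable given that the first equals \<open>s\<close>, namely normal with mean r s and
  variance 1 - r^2.\<close>

lemma integral_mehler:
  assumes "0 < r" "r < 1"
  shows "(\<integral>t. mehler r s t \<partial>std_normal_distribution) = 1"
proof -
  have r: "0 < 1 - r\<^sup>2" using assms by (simp add: power_less_one_iff)
  have "std_normal_density t * mehler r s t = normal_density (r * s) (sqrt (1 - r\<^sup>2)) t" for t
  proof -
    have "- t\<^sup>2 / 2 + - (r\<^sup>2 * s\<^sup>2 + r\<^sup>2 * t\<^sup>2 - 2 * r * s * t) / (2 * (1 - r\<^sup>2)) =
        - (t - r * s)\<^sup>2 / (2 * (1 - r\<^sup>2))"
      using r by (simp add: divide_simps power2_eq_square) (simp add: algebra_simps)
    then show ?thesis
      using r by (simp add: std_normal_density_def normal_density_def mehler_def real_sqrt_mult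
          flip: exp_add)
  qed
  moreover have "(\<integral>t. mehler r s t \<partial>std_normal_distribution) =
      (\<integral>t. std_normal_density t * mehler r s t \<partial>lborel)"
    unfolding mehler_def by (subst integral_density) auto
  ultimately show ?thesis using r by simp
qed

text \<open>Under the hypothesis on \<open>C\<close> the coordinates behave as independent standard
  normals, so the integral factorises into conditional densities of mass one. With \<open>s\<close>
  read off from the other variable this is a marginal condition for the coupling.\<close>

lemma gaussian_nn_integral_prod_mehler:
  fixes h :: "'i \<Rightarrow> 'h::{real_inner, second_countable_topology}"
  assumes G: "is_gaussian M m C" and "finite J"
    and C: "\<And>w. C (\<Sum>i\<in>J. w i *\<^sub>R h i) \<bullet> (\<Sum>i\<in>J. w i *\<^sub>R h i) = (\<Sum>i\<in>J. (w i)\<^sup>2)"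
    and r: "\<And>i. i \<in> J \<Longrightarrow> 0 < r i \<and> r i < 1"
  shows "(\<integral>\<^sup>+x. ennreal (\<Prod>i\<in>J. mehler (r i) (s i) ((x - m) \<bullet> h i)) \<partial>M) = 1"
proof -
  interpret M: prob_space M using G by (simp add: is_gaussian_def)
  have [measurable]: "(\<lambda>x. (x - m) \<bullet> h i) \<in> borel_measurable M" for i
    by (rule borel_measurable_gaussian[OF _ G]) measurable
  define \<alpha> where "\<alpha> i = (r i)\<^sup>2 / (2 * (1 - (r i)\<^sup>2))" for i
  define K where "K i = exp ((s i)\<^sup>2 / 2) / sqrt (1 - (r i)\<^sup>2)" for i
  define g where "g x = (\<Prod>i\<in>J. exp (- \<alpha> i * ((x - m) \<bullet> h i - s i / r i)\<^sup>2))" for x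
  have r2: "(r i)\<^sup>2 < 1" if "i \<in> J" for i using r[OF that] by (simp add: power_less_one_iff)
  have \<alpha>: "0 \<le> \<alpha> i" if "i \<in> J" for i using r2[OF that] by (simp add: \<alpha>_def)
  have K: "0 \<le> K i" if "i \<in> J" for i using r2[OF that] by (simp add: K_def)
  have meh: "mehler (r i) (s i) t = K i * exp (- \<alpha> i * (t - s i / r i)\<^sup>2)" if "i \<in> J" for i t
    using mehler_eq_exp_square r[OF that] by (simp add: K_def \<alpha>_def)
  then have eq: "(\<Prod>i\<in>J. mehler (r i) (s i) ((x - m) \<bullet> h i)) = (\<Prod>i\<in>J. K i) * g x" for x
    by (simp add: g_def prod.distrib)
  have [measurable]: "g \<in> borel_measurable M" unfolding g_def by measurable
  have g: "0 \<le> g x" "g x \<le> 1" for x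
    unfolding g_def using \<alpha> by (auto intro!: prod_nonneg prod_le_1)
  then have int: "integrable M g" by (intro M.integrable_const_bound[of _ 1]) auto
  have "(\<integral>x. g x \<partial>M) = (\<Prod>i\<in>J. \<integral>t. exp (- \<alpha> i * (t - s i / r i)\<^sup>2) \<partial>std_normal_distribution)"
    unfolding g_def by (rule gaussian_integral_prod_exp_square[OF G \<open>finite J\<close> C \<alpha>])
  then have "(\<integral>x. (\<Prod>i\<in>J. K i) * g x \<partial>M) =
      (\<Prod>i\<in>J. \<integral>t. K i * exp (- \<alpha> i * (t - s i / r i)\<^sup>2) \<partial>std_normal_distribution)"
    by (simp add: prod.distrib)
  also have "\<dots> = 1"
    using r integral_mehler by (intro prod.neutral ballI) (simp only: meh[symmetric])
  finally have one: "(\<integral>x. (\<Prod>i\<in>J. K i) * g x \<partial>M) = 1" .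
  have "(\<integral>\<^sup>+x. ennreal ((\<Prod>i\<in>J. K i) * g x) \<partial>M) = ennreal (\<integral>x. (\<Prod>i\<in>J. K i) * g x \<partial>M)"
    using int g K by (intro nn_integral_eq_integral) (auto intro!: mult_nonneg_nonneg prod_nonneg)
  then show ?thesis unfolding eq one by simp
qed

section \<open>Entropic optimal transport from potentials\<close>

text \<open>Gibbs' inequality, from ln t <= t - 1 at t = g / q, where q is the density of
  \<open>\<gamma>\<close>, integrated against \<open>\<gamma>\<close>.\<close>

lemma integral_ln_le_integral_ln_RN_deriv:
  assumes P: "prob_space P" and \<gamma>: "prob_space \<gamma>" and sets: "sets \<gamma> = sets P"
    and ac: "absolutely_continuous P \<gamma>"
    and g [measurable]: "g \<in> borel_measurable P" and pos: "\<And>z. 0 < g z" and "(\<integral>\<^sup>+z. ennreal (g z) \<partial>P) \<le> 1"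
    and int_g: "integrable \<gamma> (\<lambda>z. ln (g z))"
    and int_RN: "integrable \<gamma> (\<lambda>z. ln (enn2real (RN_deriv P \<gamma> z)))"
  shows "(\<integral>z. ln (g z) \<partial>\<gamma>) \<le> (\<integral>z. ln (enn2real (RN_deriv P \<gamma> z)) \<partial>\<gamma>)"
proof -
  interpret P: prob_space P by fact
  interpret \<gamma>: prob_space \<gamma> by fact
  define q where "q z = enn2real (RN_deriv P \<gamma> z)" for z
  have [measurable]: "g \<in> borel_measurable \<gamma>" "q \<in> borel_measurable \<gamma>" "q \<in> borel_measurable P"
    unfolding q_def measurable_cong_sets[OF sets refl] by measurable
  have dens: "density P (RN_deriv P \<gamma>) = \<gamma>"
    by (rule P.density_RN_deriv[OF ac sets])
  have fin: "AE z in P. RN_deriv P \<gamma> z \<noteq> \<infinity>"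
    by (rule P.RN_deriv_finite[OF \<gamma>.sigma_finite_measure_axioms ac sets])
  have q_pos: "AE z in \<gamma>. 0 < q z"
    by (subst dens[symmetric], subst AE_density)
      (use fin in \<open>auto simp: q_def enn2real_positive_iff less_top elim: eventually_mono\<close>)
  have "(\<integral>\<^sup>+z. ennreal (g z / q z) \<partial>\<gamma>) = (\<integral>\<^sup>+z. RN_deriv P \<gamma> z * ennreal (g z / q z) \<partial>P)"
    using P.RN_deriv_nn_integral[OF ac sets, of "\<lambda>z. ennreal (g z / q z)"] by simp
  also have "\<dots> \<le> (\<integral>\<^sup>+z. ennreal (g z) \<partial>P)"
  proof (rule nn_integral_mono_AE)
    \<comment> \<open>Where \<open>q\<close> vanishes the left side is 0 while \<open>g\<close> is
      positive, so only an inequality holds; it suffices.\<close>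
    show "AE z in P. RN_deriv P \<gamma> z * ennreal (g z / q z) \<le> ennreal (g z)"
      using fin
    proof eventually_elim
      case (elim z)
      then have "RN_deriv P \<gamma> z = ennreal (q z)" by (simp add: q_def less_top)
      moreover have "0 \<le> q z" by (simp add: q_def)
      ultimately show ?case using pos[of z]
        by (cases "q z = 0") (simp_all add: ennreal_mult[symmetric] less_imp_le)
    qed
  qed
  finally have le1: "(\<integral>\<^sup>+z. ennreal (g z / q z) \<partial>\<gamma>) \<le> 1" using assms(7) by simp
  have nn: "0 \<le> g z / q z" for z using pos[of z] by (simp add: q_def less_imp_le)
  have int: "integrable \<gamma> (\<lambda>z. g z / q z)"
    using nn le1 by (intro integrableI_nonneg) (auto intro: le_less_trans)
  have "ennreal (\<integral>z. g z / q z \<partial>\<gamma>) \<le> 1"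
    using nn_integral_eq_integral[OF int] nn le1 by simp
  then have ratio: "(\<integral>z. g z / q z \<partial>\<gamma>) \<le> 1" by simp
  have "(\<integral>z. ln (g z) - ln (q z) \<partial>\<gamma>) \<le> (\<integral>z. g z / q z - 1 \<partial>\<gamma>)"
  proof (rule integral_mono_AE)
    show "AE z in \<gamma>. ln (g z) - ln (q z) \<le> g z / q z - 1"
      using q_pos
    proof eventually_elim
      case (elim z)
      then show ?case using pos[of z] ln_le_minus_one[of "g z / q z"] by (simp add: ln_div)
    qed
  qed (use int_g int_RN int in \<open>auto simp: q_def\<close>)
  then show ?thesis
    using int_g int_RN int ratio by (simp add: q_def \<gamma>.prob_space)
qed

text \<open>The marginal conditions are the Schroedinger system for the quadratic cost, with
  \<open>a\<close> and \<open>b\<close> as dual potentials. The factorisation of \<open>g\<close> is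
  asked for only almost everywhere, because with degenerate covariances the cross term is diagonal
  only almost surely.\<close>

locale schroedinger_potentials =
  fixes \<mu> \<nu> :: "'h::{real_normed_vector, second_countable_topology} measure"
    and \<epsilon> :: real and g :: "'h \<times> 'h \<Rightarrow> real" and a b :: "'h \<Rightarrow> real"
  assumes prob_\<mu>: "prob_space \<mu>" and prob_\<nu>: "prob_space \<nu>"
    and sets_\<mu> [measurable_cong]: "sets \<mu> = sets borel" and sets_\<nu> [measurable_cong]: "sets \<nu> = sets borel"
    and \<epsilon>_pos: "0 < \<epsilon>"
    and g_meas [measurable]: "g \<in> borel_measurable (borel \<Otimes>\<^sub>M borel)"
    and g_pos: "\<And>z. 0 < g z"
    and marginal_fst: "\<And>x. (\<integral>\<^sup>+y. ennreal (g (x, y)) \<partial>\<nu>) = 1"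
    and marginal_snd: "\<And>y. (\<integral>\<^sup>+x. ennreal (g (x, y)) \<partial>\<mu>) = 1"
    and potentials: "AE z in \<mu> \<Otimes>\<^sub>M \<nu>. \<epsilon> * ln (g z) = a (fst z) + b (snd z) - (norm (fst z - snd z))\<^sup>2"
    and int_a: "integrable \<mu> a" and int_b: "integrable \<nu> b"
    and moment_\<mu>: "integrable \<mu> (\<lambda>x. (norm x)\<^sup>2)" and moment_\<nu>: "integrable \<nu> (\<lambda>x. (norm x)\<^sup>2)"
begin

sublocale \<mu>: prob_space \<mu> by (rule prob_\<mu>)
sublocale \<nu>: prob_space \<nu> by (rule prob_\<nu>)
sublocale pair_prob_space \<mu> \<nu> ..

lemma coupling_fst:
  fixes f :: "'h \<Rightarrow> real"
  assumes "\<gamma> \<in> Joint \<mu> \<nu>" and "integrable \<mu> f"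
  shows "integrable \<gamma> (\<lambda>z. f (fst z))" "(\<integral>z. f (fst z) \<partial>\<gamma>) = (\<integral>x. f x \<partial>\<mu>)"
proof -
  have \<gamma>: "sets \<gamma> = sets (\<mu> \<Otimes>\<^sub>M \<nu>)" "distr \<gamma> \<mu> fst = \<mu>" using assms(1) by (auto simp: Joint_def)
  have "fst \<in> measurable \<gamma> \<mu>" using measurable_cong_sets[OF \<gamma>(1) refl] measurable_fst by blast
  moreover have "f \<in> borel_measurable \<mu>" using assms(2) by simp
  ultimately show "integrable \<gamma> (\<lambda>z. f (fst z))" "(\<integral>z. f (fst z) \<partial>\<gamma>) = (\<integral>x. f x \<partial>\<mu>)"
    using integrable_distr_eq[of fst \<gamma> \<mu> f] integral_distr[of fst \<gamma> \<mu> f] assms(2) \<gamma>(2) by simp_all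
qed

lemma coupling_snd:
  fixes f :: "'h \<Rightarrow> real"
  assumes "\<gamma> \<in> Joint \<mu> \<nu>" and "integrable \<nu> f"
  shows "integrable \<gamma> (\<lambda>z. f (snd z))" "(\<integral>z. f (snd z) \<partial>\<gamma>) = (\<integral>x. f x \<partial>\<nu>)"
proof -
  have \<gamma>: "sets \<gamma> = sets (\<mu> \<Otimes>\<^sub>M \<nu>)" "distr \<gamma> \<nu> snd = \<nu>" using assms(1) by (auto simp: Joint_def)
  have "snd \<in> measurable \<gamma> \<nu>" using measurable_cong_sets[OF \<gamma>(1) refl] measurable_snd by blast
  moreover have "f \<in> borel_measurable \<nu>" using assms(2) by simp
  ultimately show "integrable \<gamma> (\<lambda>z. f (snd z))" "(\<integral>z. f (snd z) \<partial>\<gamma>) = (\<integral>x. f x \<partial>\<nu>)"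
    using integrable_distr_eq[of snd \<gamma> \<nu> f] integral_distr[of snd \<gamma> \<nu> f] assms(2) \<gamma>(2) by simp_all
qed

lemma sets_pair [measurable_cong]: "sets (\<mu> \<Otimes>\<^sub>M \<nu>) = sets (borel \<Otimes>\<^sub>M borel)"
  by (rule sets_pair_measure_cong[OF sets_\<mu> sets_\<nu>])

lemma cost_measurable [measurable]:
  "(\<lambda>z::'h \<times> 'h. (norm (fst z - snd z))\<^sup>2) \<in> borel_measurable (borel \<Otimes>\<^sub>M borel)"
  by measurable

text \<open>Second moments make the cost of every coupling finite, so the objective can be handled
  with real integrals and only \<open>KL\<close> can be infinite.\<close>

lemma cost_integrable:
  assumes "\<gamma> \<in> Joint \<mu> \<nu>"
  shows "integrable \<gamma> (\<lambda>z. (norm (fst z - snd z))\<^sup>2)"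
proof (rule Bochner_Integration.integrable_bound)
  show "integrable \<gamma> (\<lambda>z. 2 * (norm (fst z))\<^sup>2 + 2 * (norm (snd z))\<^sup>2)"
    using coupling_fst(1)[OF assms moment_\<mu>] coupling_snd(1)[OF assms moment_\<nu>] by simp
  have "sets \<gamma> = sets (borel \<Otimes>\<^sub>M borel)" using assms sets_pair by (simp add: Joint_def)
  then show "(\<lambda>z. (norm (fst z - snd z))\<^sup>2) \<in> borel_measurable \<gamma>"
    using measurable_cong_sets[of \<gamma> "borel \<Otimes>\<^sub>M borel" borel borel] cost_measurable by blast
  have "(norm (x - y))\<^sup>2 \<le> 2 * (norm x)\<^sup>2 + 2 * (norm y)\<^sup>2" for x y :: 'h
  proof -
    have "(norm (x - y))\<^sup>2 \<le> (norm x + norm y)\<^sup>2"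
      by (intro power_mono norm_triangle_ineq4) simp
    also have "\<dots> \<le> 2 * (norm x)\<^sup>2 + 2 * (norm y)\<^sup>2"
      using sum_squares_bound[of "norm x" "norm y"] by (simp add: power2_sum)
    finally show ?thesis .
  qed
  then show "AE z in \<gamma>. norm ((norm (fst z - snd z))\<^sup>2) \<le> norm (2 * (norm (fst z))\<^sup>2 + 2 * (norm (snd z))\<^sup>2)"
    by simp
qed

lemma cost_nn_integral:
  assumes "\<gamma> \<in> Joint \<mu> \<nu>"
  shows "enn2ereal (\<integral>\<^sup>+z. ennreal ((norm (fst z - snd z))\<^sup>2) \<partial>\<gamma>) = ereal (\<integral>z. (norm (fst z - snd z))\<^sup>2 \<partial>\<gamma>)"
  by (subst nn_integral_eq_integral[OF cost_integrable[OF assms]]) (simp_all add: enn2ereal_ennreal)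

text \<open>The potentials integrate to constants fixed by the marginals, so the left-hand sum does
  not depend on the coupling. Absolute continuity carries the almost-everywhere factorisation of
  \<open>g\<close> over to \<open>\<gamma>\<close>.\<close>

lemma ln_g_coupling:
  assumes J: "\<gamma> \<in> Joint \<mu> \<nu>" and ac: "absolutely_continuous (\<mu> \<Otimes>\<^sub>M \<nu>) \<gamma>"
  shows "integrable \<gamma> (\<lambda>z. ln (g z))"
    and "(\<integral>z. (norm (fst z - snd z))\<^sup>2 \<partial>\<gamma>) + \<epsilon> * (\<integral>z. ln (g z) \<partial>\<gamma>) = (\<integral>x. a x \<partial>\<mu>) + (\<integral>y. b y \<partial>\<nu>)"
proof -
  have sets: "sets \<gamma> = sets (\<mu> \<Otimes>\<^sub>M \<nu>)" using J by (simp add: Joint_def)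
  have [measurable]: "g \<in> borel_measurable \<gamma>"
    using measurable_cong_sets[OF trans[OF sets sets_pair] refl] g_meas by blast
  note int = coupling_fst[OF J int_a] coupling_snd[OF J int_b] cost_integrable[OF J]
  let ?f = "\<lambda>z. (a (fst z) + b (snd z) - (norm (fst z - snd z))\<^sup>2) / \<epsilon>"
  have ae: "AE z in \<gamma>. ln (g z) = ?f z"
    using absolutely_continuous_AE[OF sets ac potentials] \<epsilon>_pos
    by (auto simp: field_simps elim!: eventually_mono)
  have int_f: "integrable \<gamma> ?f" using int by simp
  then have [measurable]: "?f \<in> borel_measurable \<gamma>" by simp
  show "integrable \<gamma> (\<lambda>z. ln (g z))"
    by (subst integrable_cong_AE[OF _ _ ae]) (simp_all add: int_f)
  have "(\<integral>z. ln (g z) \<partial>\<gamma>) = (\<integral>z. ?f z \<partial>\<gamma>)"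
    by (rule integral_cong_AE[OF _ _ ae]) simp_all
  then show "(\<integral>z. (norm (fst z - snd z))\<^sup>2 \<partial>\<gamma>) + \<epsilon> * (\<integral>z. ln (g z) \<partial>\<gamma>) = (\<integral>x. a x \<partial>\<mu>) + (\<integral>y. b y \<partial>\<nu>)"
    using int \<epsilon>_pos by simp
qed

lemma nn_integral_g: "(\<integral>\<^sup>+z. ennreal (g z) \<partial>(\<mu> \<Otimes>\<^sub>M \<nu>)) = 1"
  by (subst \<nu>.nn_integral_fst[symmetric]) (simp_all add: marginal_fst \<mu>.emeasure_space_1)

lemma optimal_coupling: "density (\<mu> \<Otimes>\<^sub>M \<nu>) (\<lambda>z. ennreal (g z)) \<in> Joint \<mu> \<nu>" (is "?\<gamma> \<in> _")
proof -
  have "prob_space ?\<gamma>"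
    by (rule prob_spaceI) (simp add: emeasure_density nn_integral_g)
  moreover have "distr ?\<gamma> \<mu> fst = \<mu>"
  proof (rule measure_eqI)
    fix A assume "A \<in> sets (distr ?\<gamma> \<mu> fst)"
    then have A [measurable]: "A \<in> sets \<mu>" by simp
    have "emeasure (distr ?\<gamma> \<mu> fst) A =
        (\<integral>\<^sup>+z. ennreal (g z) * indicator (fst -` A \<inter> space (\<mu> \<Otimes>\<^sub>M \<nu>)) z \<partial>(\<mu> \<Otimes>\<^sub>M \<nu>))"
      by (simp add: emeasure_distr emeasure_density)
    also have "\<dots> = (\<integral>\<^sup>+z. indicator A (fst z) * ennreal (g z) \<partial>(\<mu> \<Otimes>\<^sub>M \<nu>))"
      by (intro nn_integral_cong) (simp split: split_indicator)
    also have "\<dots> = (\<integral>\<^sup>+x. \<integral>\<^sup>+y. indicator A x * ennreal (g (x, y)) \<partial>\<nu> \<partial>\<mu>)"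
      by (subst \<nu>.nn_integral_fst[symmetric]) simp_all
    also have "\<dots> = emeasure \<mu> A"
      by (simp add: nn_integral_cmult marginal_fst)
    finally show "emeasure (distr ?\<gamma> \<mu> fst) A = emeasure \<mu> A" .
  qed simp
  moreover have "distr ?\<gamma> \<nu> snd = \<nu>"
  proof (rule measure_eqI)
    fix A assume "A \<in> sets (distr ?\<gamma> \<nu> snd)"
    then have A [measurable]: "A \<in> sets \<nu>" by simp
    have "emeasure (distr ?\<gamma> \<nu> snd) A =
        (\<integral>\<^sup>+z. ennreal (g z) * indicator (snd -` A \<inter> space (\<mu> \<Otimes>\<^sub>M \<nu>)) z \<partial>(\<mu> \<Otimes>\<^sub>M \<nu>))"
      by (simp add: emeasure_distr emeasure_density)
    also have "\<dots> = (\<integral>\<^sup>+z. indicator A (snd z) * ennreal (g z) \<partial>(\<mu> \<Otimes>\<^sub>M \<nu>))"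
      by (intro nn_integral_cong) (simp split: split_indicator)
    also have "\<dots> = (\<integral>\<^sup>+y. \<integral>\<^sup>+x. indicator A y * ennreal (g (x, y)) \<partial>\<mu> \<partial>\<nu>)"
      by (subst nn_integral_snd[symmetric]) simp_all
    also have "\<dots> = emeasure \<nu> A"
      by (simp add: nn_integral_cmult marginal_snd)
    finally show "emeasure (distr ?\<gamma> \<nu> snd) A = emeasure \<nu> A" .
  qed simp
  ultimately show ?thesis by (simp add: Joint_def)
qed

theorem OT_eps_eq: "OT_eps \<epsilon> \<mu> \<nu> = ereal ((\<integral>x. a x \<partial>\<mu>) + (\<integral>y. b y \<partial>\<nu>))"
proof -
  let ?P = "\<mu> \<Otimes>\<^sub>M \<nu>" and ?V = "(\<integral>x. a x \<partial>\<mu>) + (\<integral>y. b y \<partial>\<nu>)"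
  let ?obj = "\<lambda>\<gamma>. enn2ereal (\<integral>\<^sup>+ z. ennreal ((norm (fst z - snd z))\<^sup>2) \<partial>\<gamma>) + ereal \<epsilon> * KL \<gamma> ?P"
  have lower: "ereal ?V \<le> ?obj \<gamma>" if J: "\<gamma> \<in> Joint \<mu> \<nu>" for \<gamma>
  proof (cases "absolutely_continuous ?P \<gamma> \<and> integrable \<gamma> (\<lambda>z. ln (enn2real (RN_deriv ?P \<gamma> z)))")
    case True
    have "(\<integral>z. ln (g z) \<partial>\<gamma>) \<le> (\<integral>z. ln (enn2real (RN_deriv ?P \<gamma> z)) \<partial>\<gamma>)"
    proof (rule integral_ln_le_integral_ln_RN_deriv)
      show "prob_space ?P" by (rule P.prob_space_axioms)
      show "prob_space \<gamma>" "sets \<gamma> = sets ?P" using J by (simp_all add: Joint_def)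
      show "integrable \<gamma> (\<lambda>z. ln (g z))" using ln_g_coupling(1)[OF J] True by blast
    qed (use True g_pos nn_integral_g in simp_all)
    then have "\<epsilon> * (\<integral>z. ln (g z) \<partial>\<gamma>) \<le> \<epsilon> * (\<integral>z. ln (enn2real (RN_deriv ?P \<gamma> z)) \<partial>\<gamma>)"
      using \<epsilon>_pos by simp
    then have "?V \<le> (\<integral>z. (norm (fst z - snd z))\<^sup>2 \<partial>\<gamma>) + \<epsilon> * (\<integral>z. ln (enn2real (RN_deriv ?P \<gamma> z)) \<partial>\<gamma>)"
      using ln_g_coupling(2)[OF J] True by linarith
    then show ?thesis unfolding cost_nn_integral[OF J] KL_def using True by simp
  next
    case False
    \<comment> \<open>Here \<open>KL\<close> takes its default value, infinity, and the bound is
      trivial.\<close>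
    then have "KL \<gamma> ?P = \<infinity>" by (auto simp: KL_def)
    then show ?thesis unfolding cost_nn_integral[OF J] using \<epsilon>_pos by simp
  qed
  let ?\<gamma> = "density ?P (\<lambda>z. ennreal (g z))"
  have J: "?\<gamma> \<in> Joint \<mu> \<nu>" by (rule optimal_coupling)
  have ac: "absolutely_continuous ?P ?\<gamma>"
    by (rule absolutely_continuousI_density) measurable
  \<comment> \<open>\<open>RN_deriv\<close> is determined only up to null sets of the product;
    absolute continuity makes the identification with \<open>g\<close> valid under the candidate
    coupling, where \<open>KL\<close> integrates it.\<close>
  have "AE z in ?P. ennreal (g z) = RN_deriv ?P ?\<gamma> z"
    by (rule RN_deriv_unique) simp_all
  then have "AE z in ?\<gamma>. ennreal (g z) = RN_deriv ?P ?\<gamma> z"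
    by (rule absolutely_continuous_AE[OF _ ac, rotated]) simp
  then have ae: "AE z in ?\<gamma>. ln (enn2real (RN_deriv ?P ?\<gamma> z)) = ln (g z)"
    by (rule eventually_mono) (metis enn2real_ennreal g_pos less_imp_le)
  have [measurable]: "g \<in> borel_measurable ?\<gamma>" by simp
  have "integrable ?\<gamma> (\<lambda>z. ln (enn2real (RN_deriv ?P ?\<gamma> z)))"
    by (subst integrable_cong_AE[OF _ _ ae]) (simp_all add: ln_g_coupling(1)[OF J ac])
  then have "KL ?\<gamma> ?P = ereal (\<integral>z. ln (enn2real (RN_deriv ?P ?\<gamma> z)) \<partial>?\<gamma>)"
    using ac by (simp add: KL_def)
  also have "\<dots> = ereal (\<integral>z. ln (g z) \<partial>?\<gamma>)"
    by (subst integral_cong_AE[OF _ _ ae]) simp_all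
  finally have "?obj ?\<gamma> = ereal ?V"
    unfolding cost_nn_integral[OF J] using ln_g_coupling(2)[OF J ac] by simp
  then show ?thesis
    unfolding OT_eps_def using lower J by (intro antisym INF_greatest INF_lower2[OF J]) auto
qed

end

section \<open>Gaussians with finite-rank covariance\<close>

lemma AE_pair_fst:
  assumes "prob_space N" and "AE x in M. Q x"
  shows "AE z in M \<Otimes>\<^sub>M N. Q (fst z)"
proof -
  interpret N: prob_space N by fact
  obtain A where A: "{x \<in> space M. \<not> Q x} \<subseteq> A" "emeasure M A = 0" "A \<in> sets M"
    using AE_E[OF assms(2)] by blast
  show ?thesis
  proof (rule AE_I)
    show "{z \<in> space (M \<Otimes>\<^sub>M N). \<not> Q (fst z)} \<subseteq> A \<times> space N"
      using A(1) by (auto simp: space_pair_measure)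
    show "emeasure (M \<Otimes>\<^sub>M N) (A \<times> space N) = 0"
      using A by (simp add: N.emeasure_pair_measure_Times)
    show "A \<times> space N \<in> sets (M \<Otimes>\<^sub>M N)" using A by simp
  qed
qed

lemma AE_pair_snd:
  assumes "prob_space N" and "AE y in N. Q y"
  shows "AE z in M \<Otimes>\<^sub>M N. Q (snd z)"
proof -
  interpret N: prob_space N by fact
  obtain A where A: "{x \<in> space N. \<not> Q x} \<subseteq> A" "emeasure N A = 0" "A \<in> sets N"
    using AE_E[OF assms(2)] by blast
  show ?thesis
  proof (rule AE_I)
    show "{z \<in> space (M \<Otimes>\<^sub>M N). \<not> Q (snd z)} \<subseteq> space M \<times> A"
      using A(1) by (auto simp: space_pair_measure)
    show "emeasure (M \<Otimes>\<^sub>M N) (space M \<times> A) = 0"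
      using A by (simp add: N.emeasure_pair_measure_Times)
    show "space M \<times> A \<in> sets (M \<Otimes>\<^sub>M N)" using A by simp
  qed
qed

lemma gaussian_norm_sq_integrable_uncentered:
  fixes a :: "'i::finite \<Rightarrow> 'h::{real_inner, second_countable_topology}"
  assumes G: "is_gaussian M m (frame_op a)"
  shows "integrable M (\<lambda>x. (norm x)\<^sup>2)"
proof -
  interpret prob_space M using G by (simp add: is_gaussian_def)
  have eq: "(\<lambda>x. (norm x)\<^sup>2) = (\<lambda>x. (norm (x - m))\<^sup>2 + 2 * ((x - m) \<bullet> m) + (norm m)\<^sup>2)"
    by (rule ext) (simp add: power2_norm_eq_inner inner_diff_left inner_diff_right inner_commute)
  have "integrable M (\<lambda>x. (norm (x - m))\<^sup>2 + 2 * ((x - m) \<bullet> m) + (norm m)\<^sup>2)"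
    using gaussian_norm_sq_integrable[OF G] gaussian_first_moment(1)[OF G frame_op_nonneg, of m] by simp
  then show ?thesis by (subst eq)
qed

text \<open>The frame may repeat vectors, so the coefficients are indexed by the index type and not
  by the vectors themselves.\<close>

lemma span_range_imp_combination:
  fixes a :: "'i::finite \<Rightarrow> 'h::real_vector"
  assumes "x \<in> span (range a)" shows "x \<in> range (\<lambda>c. \<Sum>i\<in>UNIV. c i *\<^sub>R a i)"
  using assms
proof (induction rule: span_induct_alt)
  case base
  show ?case by (intro range_eqI[of _ _ "\<lambda>_. 0"]) simp
next
  case (step c x y)
  then obtain i f where "x = a i" "y = (\<Sum>i\<in>UNIV. f i *\<^sub>R a i)" by blast
  then show ?case
    by (intro range_eqI[of _ _ "\<lambda>j. (if j = i then c else 0) + f j"])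
      (simp add: scaleR_add_left sum.distrib if_distrib[of "\<lambda>c. c *\<^sub>R _"] cong: if_cong)
qed

lemma frame_op_sum: "frame_op a (\<Sum>i\<in>I. c i *\<^sub>R h i) = (\<Sum>i\<in>I. c i *\<^sub>R frame_op a (h i))"
  unfolding frame_op_def
  by (simp add: inner_sum_right scaleR_sum_left scaleR_sum_right sum.swap[of _ _ I])

text \<open>The correlation of the optimal coupling in one coordinate, as a function of the
  eigenvalue \<open>l\<close>; it solves \<open>r / (1 - r\<^sup>2) = 2 sqrt l / \<epsilon>\<close>.\<close>

definition sinkhorn_corr :: "real \<Rightarrow> real \<Rightarrow> real" where
  "sinkhorn_corr \<epsilon> l = \<epsilon> * (sqrt (1 + 16 / \<epsilon>\<^sup>2 * l) - 1) / (4 * sqrt l)"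

text \<open>Everything follows from r^2 = (k - 1) / (k + 1), which results from eliminating l
  through 16 l = eps^2 (k^2 - 1).\<close>

lemma
  assumes \<epsilon>: "0 < \<epsilon>" and l: "0 < l"
  defines "k \<equiv> sqrt (1 + 16 / \<epsilon>\<^sup>2 * l)" and "r \<equiv> sinkhorn_corr \<epsilon> l"
  shows sinkhorn_corr_bounds: "0 < r" "r < 1"
    and one_minus_sinkhorn_corr_sq: "1 - r\<^sup>2 = 2 / (1 + k)"
    and sinkhorn_corr_sq_ratio: "r\<^sup>2 / (2 * (1 - r\<^sup>2)) = (k - 1) / 4"
    and sinkhorn_corr_ratio: "r / (1 - r\<^sup>2) = 2 * sqrt l / \<epsilon>"
proof -
  have k2: "k\<^sup>2 = 1 + 16 / \<epsilon>\<^sup>2 * l" using l by (simp add: k_def)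
  have k: "1 < k" unfolding k_def using l \<epsilon> by simp
  have s: "0 < sqrt l" "(sqrt l)\<^sup>2 = l" using l by simp_all
  have l_eq: "16 * l = \<epsilon>\<^sup>2 * (k\<^sup>2 - 1)" using k2 \<epsilon> by (simp add: field_simps)
  have r: "r = \<epsilon> * (k - 1) / (4 * sqrt l)" by (simp add: r_def sinkhorn_corr_def k_def)
  show "0 < r" unfolding r using k \<epsilon> s by simp
  have "r\<^sup>2 = \<epsilon>\<^sup>2 * (k - 1)\<^sup>2 / (16 * l)" unfolding r using s by (simp add: power_divide power_mult_distrib)
  also have "\<dots> = (k - 1)\<^sup>2 / (k\<^sup>2 - 1)" unfolding l_eq using \<epsilon> by simp
  also have "\<dots> = (k - 1) / (k + 1)"
  proof -
    have "k\<^sup>2 - 1 = (k - 1) * (k + 1)" by (simp add: power2_eq_square algebra_simps)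
    then show ?thesis using k by (simp add: power2_eq_square)
  qed
  finally have r2: "r\<^sup>2 = (k - 1) / (k + 1)" .
  show r3: "1 - r\<^sup>2 = 2 / (1 + k)" unfolding r2 using k by (simp add: field_simps)
  show "r\<^sup>2 / (2 * (1 - r\<^sup>2)) = (k - 1) / 4" unfolding r3 r2 using k by (simp add: field_simps)
  have "r\<^sup>2 < 1\<^sup>2" unfolding r2 using k by simp
  then show "r < 1" by (rule power2_less_imp_less) simp
  have "r / (1 - r\<^sup>2) = \<epsilon> * (k\<^sup>2 - 1) / (8 * sqrt l)"
    unfolding r3 unfolding r using k s by (simp add: field_simps power2_eq_square)
  also have "\<dots> = 2 * sqrt l / \<epsilon>"
  proof -
    have "\<epsilon>\<^sup>2 * (k\<^sup>2 - 1) = 16 * (sqrt l)\<^sup>2" using l_eq s(2) by simp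
    then show ?thesis using s(1) \<epsilon> by (simp add: field_simps power2_eq_square del: real_sqrt_mult_self)
  qed
  finally show "r / (1 - r\<^sup>2) = 2 * sqrt l / \<epsilon>" .
qed

lemma quadratic_form_orthonormal:
  fixes h :: "'i \<Rightarrow> 'h::real_inner"
  assumes "finite J" and orth: "\<And>i j. i \<in> J \<Longrightarrow> j \<in> J \<Longrightarrow> frame_op a (h i) \<bullet> h j = (if i = j then 1 else 0)"
  shows "frame_op a (\<Sum>i\<in>J. w i *\<^sub>R h i) \<bullet> (\<Sum>i\<in>J. w i *\<^sub>R h i) = (\<Sum>i\<in>J. (w i)\<^sup>2)"
proof -
  have "frame_op a (\<Sum>i\<in>J. w i *\<^sub>R h i) \<bullet> (\<Sum>i\<in>J. w i *\<^sub>R h i) =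
      (\<Sum>i\<in>J. \<Sum>j\<in>J. w i * w j * (frame_op a (h i) \<bullet> h j))"
    by (simp only: frame_op_sum inner_sum_left) (simp add: inner_sum_right mult_ac sum_distrib_left)
  also have "\<dots> = (\<Sum>i\<in>J. \<Sum>j\<in>J. if j = i then w i * w i else 0)"
    using orth by (intro sum.cong refl) auto
  also have "\<dots> = (\<Sum>i\<in>J. (w i)\<^sup>2)"
    using \<open>finite J\<close> by (simp add: power2_eq_square)
  finally show ?thesis .
qed

text \<open>By \<open>diag\<close> the frame of the first covariance diagonalises the quadratic form
  of the second. The nonzero \<open>l i\<close> are the nonzero eigenvalues of the product of the
  two covariances.\<close>

theorem OT_eps_gaussian:
  fixes a :: "'i::finite \<Rightarrow> 'h::{real_inner, second_countable_topology}" and b :: "'j::finite \<Rightarrow> 'h"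
  assumes G0: "is_gaussian \<mu> m0 (frame_op a)" and G1: "is_gaussian \<nu> m1 (frame_op b)"
    and diag: "\<And>i j. frame_op b (a i) \<bullet> a j = (if i = j then l i else 0)" and \<epsilon>: "0 < \<epsilon>"
  shows "OT_eps \<epsilon> \<mu> \<nu> = ereal ((norm (m0 - m1))\<^sup>2 + (\<Sum>i\<in>UNIV. (norm (a i))\<^sup>2) + (\<Sum>j\<in>UNIV. (norm (b j))\<^sup>2)
    + (\<Sum>i\<in>UNIV. - (\<epsilon>/2) * (sqrt (1 + 16 / \<epsilon>\<^sup>2 * l i) - 1) + (\<epsilon>/2) * ln ((1 + sqrt (1 + 16 / \<epsilon>\<^sup>2 * l i)) / 2)))"
proof -
  interpret \<mu>: prob_space \<mu> using G0 by (simp add: is_gaussian_def)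
  interpret \<nu>: prob_space \<nu> using G1 by (simp add: is_gaussian_def)
  have sets [measurable_cong]: "sets \<mu> = sets borel" "sets \<nu> = sets borel"
    using G0 G1 by (simp_all add: is_gaussian_def)
  have l_nonneg: "0 \<le> l i" for i
    using frame_op_nonneg[of b "a i"] diag[of i i] by simp
  \<comment> \<open>Only positive eigenvalues yield coordinates, since \<open>u\<close> and
    \<open>v\<close> divide by them; the others turn out to contribute nothing.\<close>
  define J where "J = {i. 0 < l i}"
  define k where "k i = sqrt (1 + 16 / \<epsilon>\<^sup>2 * l i)" for i
  define r where "r i = sinkhorn_corr \<epsilon> (l i)" for i
  \<comment> \<open>\<open>u\<close> is dual to the frame on \<open>J\<close>, so pairing with it
    reads off the coefficient of \<open>a i\<close>, while \<open>v\<close> rescales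
    \<open>a i\<close> to unit variance under the second law. Both coordinate systems become
    standard normal.\<close>
  define u where "u i = (1 / l i) *\<^sub>R frame_op b (a i)" for i
  define v where "v i = (1 / sqrt (l i)) *\<^sub>R a i" for i
  have r: "0 < r i \<and> r i < 1" if "i \<in> J" for i
    using sinkhorn_corr_bounds[OF \<epsilon>, of "l i"] that by (simp add: J_def r_def)
  have finJ: "finite J" by simp
  have a_u: "a i \<bullet> u j = (if i = j then 1 else 0)" if "j \<in> J" for i j
    using diag[of j i] that by (auto simp: u_def J_def inner_commute)
  have u_orth: "frame_op a (u i) \<bullet> u j = (if i = j then 1 else 0)" if "i \<in> J" "j \<in> J" for i j
  proof -
    have "frame_op a (u i) \<bullet> u j = (\<Sum>n\<in>UNIV. if n = i then (if i = j then 1 else 0) else 0)"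
      unfolding frame_op_inner using a_u that by (intro sum.cong) auto
    then show ?thesis by simp
  qed
  have v_orth: "frame_op b (v i) \<bullet> v j = (if i = j then 1 else 0)" if "i \<in> J" "j \<in> J" for i j
  proof -
    have "frame_op b (v i) = (1 / sqrt (l i)) *\<^sub>R frame_op b (a i)"
      using frame_op_sum[of b "\<lambda>_. 1 / sqrt (l i)" a "{i}"] by (simp add: v_def)
    then show ?thesis using diag[of i j] that by (auto simp: v_def J_def real_sqrt_mult_self abs_of_pos)
  qed
  define X where "X i x = (x - m0) \<bullet> u i" for i x
  define Y where "Y i y = (y - m1) \<bullet> v i" for i y
  define g where "g z = (\<Prod>i\<in>J. mehler (r i) (X i (fst z)) (Y i (snd z)))" for z
  \<comment> \<open>The difference of means adds to the cost only a constant and two centred linear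
    terms; these go into the potentials and disappear on integration, leaving |d|^2.\<close>
  define d where "d = m0 - m1"
  define \<phi> where "\<phi> x = (norm (x - m0))\<^sup>2 + 2 * ((x - m0) \<bullet> d) + (norm d)\<^sup>2
    - (\<Sum>i\<in>J. \<epsilon> * (k i - 1) / 4 * (X i x)\<^sup>2)" for x
  define \<psi> where "\<psi> y = (norm (y - m1))\<^sup>2 - 2 * ((y - m1) \<bullet> d)
    + (\<Sum>i\<in>J. (\<epsilon> / 2) * ln ((1 + k i) / 2) - \<epsilon> * (k i - 1) / 4 * (Y i y)\<^sup>2)" for y
  have X_moment: "integrable \<mu> (\<lambda>x. (X i x)\<^sup>2)" "(\<integral>x. (X i x)\<^sup>2 \<partial>\<mu>) = 1" if "i \<in> J" for i
    using gaussian_second_moment[OF G0 frame_op_nonneg, of "u i"] u_orth[OF that that] by (simp_all add: X_def)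
  have Y_moment: "integrable \<nu> (\<lambda>x. (Y i x)\<^sup>2)" "(\<integral>x. (Y i x)\<^sup>2 \<partial>\<nu>) = 1" if "i \<in> J" for i
    using gaussian_second_moment[OF G1 frame_op_nonneg, of "v i"] v_orth[OF that that] by (simp_all add: Y_def)
  have cross: "AE z in \<mu> \<Otimes>\<^sub>M \<nu>.
      (fst z - m0) \<bullet> (snd z - m1) = (\<Sum>i\<in>J. sqrt (l i) * X i (fst z) * Y i (snd z))"
  proof -
    \<comment> \<open>Expanding \<open>x - m0\<close> in the frame produces all indices. Those
      outside \<open>J\<close> pair with directions in which the second law has variance zero, so
      they drop out almost surely.\<close>
    have "AE y in \<nu>. \<forall>i\<in>-J. (y - m1) \<bullet> a i = 0"
    proof (rule AE_finite_allI)
      fix i assume "i \<in> - J"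
      then have "l i = 0" using l_nonneg[of i] by (simp add: J_def)
      then show "AE y in \<nu>. (y - m1) \<bullet> a i = 0"
        using diag[of i i] by (intro gaussian_AE_orthogonal[OF G1]) simp
    qed simp
    from AE_pair_snd[OF \<nu>.prob_space_axioms this]
      AE_pair_fst[OF \<nu>.prob_space_axioms gaussian_AE_in_span[OF G0]]
    show ?thesis
    proof eventually_elim
      case (elim z)
      have "fst z - m0 \<in> range (\<lambda>c. \<Sum>i\<in>UNIV. c i *\<^sub>R a i)"
        using elim(2) by (rule span_range_imp_combination)
      then obtain c where c: "fst z - m0 = (\<Sum>i\<in>UNIV. c i *\<^sub>R a i)" by blast
      have X: "X i (fst z) = c i" if "i \<in> J" for i
      proof -
        have "X i (fst z) = (\<Sum>n\<in>UNIV. if n = i then c i else 0)"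
          unfolding X_def c inner_sum_left using a_u[OF that] by (intro sum.cong) auto
        then show ?thesis by simp
      qed
      have "(fst z - m0) \<bullet> (snd z - m1) = (\<Sum>i\<in>UNIV. c i * ((snd z - m1) \<bullet> a i))"
        unfolding c inner_sum_left by (simp add: inner_commute)
      also have "\<dots> = (\<Sum>i\<in>J. c i * ((snd z - m1) \<bullet> a i))"
        using elim(1) by (intro sum.mono_neutral_right) auto
      also have "\<dots> = (\<Sum>i\<in>J. sqrt (l i) * X i (fst z) * Y i (snd z))"
        using X by (intro sum.cong) (auto simp: Y_def v_def J_def)
      finally show ?case .
    qed
  qed
  interpret schroedinger_potentials \<mu> \<nu> \<epsilon> g \<phi> \<psi>
  proof
    show "g \<in> borel_measurable (borel \<Otimes>\<^sub>M borel)"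
      unfolding g_def mehler_def X_def Y_def by measurable
    show "0 < g z" for z
      unfolding g_def using r by (intro prod_pos) (auto intro: mehler_pos)
    show "(\<integral>\<^sup>+y. ennreal (g (x, y)) \<partial>\<nu>) = 1" for x
      using gaussian_nn_integral_prod_mehler[OF G1 finJ quadratic_form_orthonormal[OF finJ v_orth] r, where s = "\<lambda>i. X i x"]
      by (simp add: g_def Y_def)
    show "(\<integral>\<^sup>+x. ennreal (g (x, y)) \<partial>\<mu>) = 1" for y
      using gaussian_nn_integral_prod_mehler[OF G0 finJ quadratic_form_orthonormal[OF finJ u_orth] r, where s = "\<lambda>i. Y i y"]
      by (simp add: g_def X_def mehler_commute[of _ "Y _ y"])
    show "integrable \<mu> \<phi>"
      unfolding \<phi>_def using gaussian_norm_sq_integrable[OF G0] gaussian_first_moment[OF G0 frame_op_nonneg] X_moment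
      by (intro Bochner_Integration.integrable_add Bochner_Integration.integrable_diff
          Bochner_Integration.integrable_sum integrable_mult_right) auto
    show "integrable \<nu> \<psi>"
      unfolding \<psi>_def using gaussian_norm_sq_integrable[OF G1] gaussian_first_moment[OF G1 frame_op_nonneg] Y_moment
      by (intro Bochner_Integration.integrable_add Bochner_Integration.integrable_diff
          Bochner_Integration.integrable_sum integrable_mult_right) auto
    show "integrable \<mu> (\<lambda>x. (norm x)\<^sup>2)" "integrable \<nu> (\<lambda>x. (norm x)\<^sup>2)"
      using gaussian_norm_sq_integrable_uncentered G0 G1 by blast+
    show "AE z in \<mu> \<Otimes>\<^sub>M \<nu>. \<epsilon> * ln (g z) = \<phi> (fst z) + \<psi> (snd z) - (norm (fst z - snd z))\<^sup>2"
      using cross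
    proof eventually_elim
      case (elim z)
      have "\<epsilon> * ln (g z) = (\<Sum>i\<in>J. \<epsilon> * ln (mehler (r i) (X i (fst z)) (Y i (snd z))))"
        unfolding g_def using r by (subst ln_prod) (auto simp: sum_distrib_left mehler_pos less_imp_neq[symmetric])
      also have "\<dots> = (\<Sum>i\<in>J. ((\<epsilon> / 2) * ln ((1 + k i) / 2) - \<epsilon> * (k i - 1) / 4 * (Y i (snd z))\<^sup>2)
          - \<epsilon> * (k i - 1) / 4 * (X i (fst z))\<^sup>2 + 2 * (sqrt (l i) * X i (fst z) * Y i (snd z)))"
      proof (rule sum.cong[OF refl])
        fix i assume i: "i \<in> J"
        then have li: "0 < l i" by (simp add: J_def)
        have k: "1 \<le> k i" unfolding k_def using li by simp
        have e: "ln (1 - (r i)\<^sup>2) = - ln ((1 + k i) / 2)"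
          unfolding r_def one_minus_sinkhorn_corr_sq[OF \<epsilon> li]
          using k by (simp add: ln_div k_def)
        have lm: "ln (mehler (r i) x y) = - ((k i - 1) / 4) * (x\<^sup>2 + y\<^sup>2) + 2 * sqrt (l i) / \<epsilon> * x * y
            + ln ((1 + k i) / 2) / 2" for x y
          unfolding ln_mehler[OF conjunct1[OF r[OF i]] conjunct2[OF r[OF i]]] e
            sinkhorn_corr_sq_ratio[OF \<epsilon> li, folded r_def k_def] sinkhorn_corr_ratio[OF \<epsilon> li, folded r_def]
          by simp
        show "\<epsilon> * ln (mehler (r i) (X i (fst z)) (Y i (snd z))) =
            ((\<epsilon> / 2) * ln ((1 + k i) / 2) - \<epsilon> * (k i - 1) / 4 * (Y i (snd z))\<^sup>2)
            - \<epsilon> * (k i - 1) / 4 * (X i (fst z))\<^sup>2 + 2 * (sqrt (l i) * X i (fst z) * Y i (snd z))"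
          unfolding lm using \<epsilon> by (simp add: field_simps)
      qed
      also have "\<dots> = (\<Sum>i\<in>J. (\<epsilon> / 2) * ln ((1 + k i) / 2) - \<epsilon> * (k i - 1) / 4 * (Y i (snd z))\<^sup>2)
          - (\<Sum>i\<in>J. \<epsilon> * (k i - 1) / 4 * (X i (fst z))\<^sup>2) + 2 * ((fst z - m0) \<bullet> (snd z - m1))"
        unfolding elim by (simp only: sum.distrib sum_subtractf sum_distrib_left)
      also have "2 * ((fst z - m0) \<bullet> (snd z - m1)) = (norm (fst z - m0))\<^sup>2 + 2 * ((fst z - m0) \<bullet> d) + (norm d)\<^sup>2
          + (norm (snd z - m1))\<^sup>2 - 2 * ((snd z - m1) \<bullet> d) - (norm (fst z - snd z))\<^sup>2"
      proof -
        have expand: "(norm (p - q + w))\<^sup>2 = (norm p)\<^sup>2 + (norm q)\<^sup>2 + (norm w)\<^sup>2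
            + 2 * (p \<bullet> w) - 2 * (q \<bullet> w) - 2 * (p \<bullet> q)" for p q w :: 'h
          by (simp add: power2_norm_eq_inner inner_diff_left inner_diff_right inner_add_left
              inner_add_right inner_commute)
        have "fst z - snd z = (fst z - m0) - (snd z - m1) + d" by (simp add: d_def)
        then have "norm (fst z - snd z) = norm ((fst z - m0) - (snd z - m1) + d)" by (rule arg_cong)
        then show ?thesis using expand[of "fst z - m0" "snd z - m1" d] by simp
      qed
      finally show ?case by (simp add: \<phi>_def \<psi>_def)
    qed
  qed (use \<mu>.prob_space_axioms \<nu>.prob_space_axioms sets \<epsilon> in simp_all)
  have "(\<integral>x. \<phi> x \<partial>\<mu>) = (\<Sum>i\<in>UNIV. (norm (a i))\<^sup>2) + (norm d)\<^sup>2 - (\<Sum>i\<in>J. \<epsilon> * (k i - 1) / 4)"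
    unfolding \<phi>_def using gaussian_norm_sq_integrable[OF G0] gaussian_first_moment[OF G0 frame_op_nonneg] X_moment
      gaussian_norm_sq_integral[OF G0] \<mu>.prob_space
    by (simp add: Bochner_Integration.integral_sum)
  moreover have "(\<integral>y. \<psi> y \<partial>\<nu>) = (\<Sum>j\<in>UNIV. (norm (b j))\<^sup>2)
      + (\<Sum>i\<in>J. (\<epsilon> / 2) * ln ((1 + k i) / 2) - \<epsilon> * (k i - 1) / 4)"
    unfolding \<psi>_def using gaussian_norm_sq_integrable[OF G1] gaussian_first_moment[OF G1 frame_op_nonneg] Y_moment
      gaussian_norm_sq_integral[OF G1] \<nu>.prob_space
    by (simp add: Bochner_Integration.integral_sum)
  ultimately have "(\<integral>x. \<phi> x \<partial>\<mu>) + (\<integral>y. \<psi> y \<partial>\<nu>) = (norm d)\<^sup>2 + (\<Sum>i\<in>UNIV. (norm (a i))\<^sup>2) + (\<Sum>j\<in>UNIV. (norm (b j))\<^sup>2)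
      + ((\<Sum>i\<in>J. (\<epsilon> / 2) * ln ((1 + k i) / 2) - \<epsilon> * (k i - 1) / 4) - (\<Sum>i\<in>J. \<epsilon> * (k i - 1) / 4))"
    by simp
  also have "(\<Sum>i\<in>J. (\<epsilon> / 2) * ln ((1 + k i) / 2) - \<epsilon> * (k i - 1) / 4) - (\<Sum>i\<in>J. \<epsilon> * (k i - 1) / 4) =
      (\<Sum>i\<in>J. - (\<epsilon>/2) * (k i - 1) + (\<epsilon>/2) * ln ((1 + k i) / 2))"
    unfolding sum_subtractf[symmetric] by (rule sum.cong) (simp_all add: field_simps)
  \<comment> \<open>For a zero eigenvalue \<open>k i\<close> is 1, and both parts of the summand
    vanish.\<close>
  also have "\<dots> = (\<Sum>i\<in>UNIV. - (\<epsilon>/2) * (k i - 1) + (\<epsilon>/2) * ln ((1 + k i) / 2))"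
  proof (rule sum.mono_neutral_left)
    show "\<forall>i\<in>UNIV - J. - (\<epsilon>/2) * (k i - 1) + (\<epsilon>/2) * ln ((1 + k i) / 2) = 0"
    proof
      fix i assume "i \<in> UNIV - J"
      then have "l i = 0" using l_nonneg[of i] by (simp add: J_def)
      then show "- (\<epsilon>/2) * (k i - 1) + (\<epsilon>/2) * ln ((1 + k i) / 2) = 0" by (simp add: k_def)
    qed
  qed simp_all
  finally show ?thesis using OT_eps_eq by (simp add: d_def k_def)
qed

section \<open>Empirical Gaussians in feature space\<close>

lemma transpose_centering [simp]: "transpose centering = centering"
  by (simp add: vec_eq_iff centering_def transpose_def mat_def)

lemma centering_idem: "(centering :: real^'n^'n) ** centering = centering"
proof -
  let ?U = "(\<chi> i j. 1 / real CARD('n)) :: real^'n^'n"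
  have "?U ** ?U = ?U" by (simp add: vec_eq_iff matrix_matrix_mult_def)
  then have "(mat 1 + (-1) *\<^sub>R ?U) ** (mat 1 + (-1) *\<^sub>R ?U) = mat 1 + (-1) *\<^sub>R ?U"
    by (simp only: matrix_add_ldistrib matrix_add_rdistrib matrix_scalar_ac
        scalar_matrix_assoc[symmetric] matrix_mul_lid matrix_mul_rid) simp
  then show ?thesis by (simp add: centering_def)
qed

lemma sum_centering: "(\<Sum>k\<in>UNIV. (centering :: real^'n^'n) $ k $ i * centering $ k $ j) = centering $ i $ j"
proof -
  have "(\<Sum>k\<in>UNIV. (centering :: real^'n^'n) $ k $ i * centering $ k $ j) =
      (transpose centering ** (centering :: real^'n^'n)) $ i $ j"
    by (simp add: matrix_matrix_mult_def transpose_def)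
  then show ?thesis by (simp add: centering_idem)
qed

text \<open>The columns of \<open>\<Phi>(X) J / sqrt m\<close>, where \<open>J\<close> is the centering matrix.\<close>

definition centered_features :: "('x \<Rightarrow> 'h::real_inner) \<Rightarrow> ('n::finite \<Rightarrow> 'x) \<Rightarrow> 'n \<Rightarrow> 'h" where
  "centered_features \<Phi> X k = (1 / sqrt (real CARD('n))) *\<^sub>R
     (\<Sum>j\<in>UNIV. (centering :: real^'n^'n) $ k $ j *\<^sub>R \<Phi> (X j))"

text \<open>The centering matrix is a symmetric idempotent, so inserting its square between the
  feature operator and its adjoint displays the covariance as a frame operator.\<close>

lemma emp_cov_eq_frame_op:
  fixes X :: "'n::finite \<Rightarrow> 'x"
  shows "emp_cov \<Phi> X = frame_op (centered_features \<Phi> X)"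
proof
  fix h
  let ?m = "real CARD('n)" and ?J = "centering :: real^'n^'n"
  have "frame_op (centered_features \<Phi> X) h =
      (\<Sum>k\<in>UNIV. \<Sum>i\<in>UNIV. \<Sum>j\<in>UNIV. (1 / ?m * (?J $ k $ i * ?J $ k $ j) * (\<Phi> (X j) \<bullet> h)) *\<^sub>R \<Phi> (X i))"
    unfolding frame_op_def centered_features_def
    by (simp add: inner_sum_left scaleR_sum_left scaleR_sum_right sum_distrib_left sum_distrib_right
        sum_divide_distrib mult_ac)
  also have "\<dots> = (\<Sum>i\<in>UNIV. \<Sum>k\<in>UNIV. \<Sum>j\<in>UNIV. (1 / ?m * (?J $ k $ i * ?J $ k $ j) * (\<Phi> (X j) \<bullet> h)) *\<^sub>R \<Phi> (X i))"
    by (rule sum.swap)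
  also have "\<dots> = (\<Sum>i\<in>UNIV. \<Sum>j\<in>UNIV. \<Sum>k\<in>UNIV. (1 / ?m * (?J $ k $ i * ?J $ k $ j) * (\<Phi> (X j) \<bullet> h)) *\<^sub>R \<Phi> (X i))"
    by (intro sum.cong refl sum.swap)
  also have "\<dots> = (\<Sum>i\<in>UNIV. \<Sum>j\<in>UNIV. (1 / ?m * ?J $ i $ j * (\<Phi> (X j) \<bullet> h)) *\<^sub>R \<Phi> (X i))"
    by (simp only: scaleR_sum_left[symmetric] sum_distrib_right[symmetric] sum_distrib_left[symmetric] sum_centering)
  also have "\<dots> = emp_cov \<Phi> X h"
    by (simp add: emp_cov_def scaleR_sum_right)
  finally show "emp_cov \<Phi> X h = frame_op (centered_features \<Phi> X) h" ..
qed

lemma inner_centered_features: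
  fixes X Y :: "'n::finite \<Rightarrow> 'x"
  assumes K: "\<And>x y. K x y = \<Phi> x \<bullet> \<Phi> y"
  shows "centered_features \<Phi> X k \<bullet> centered_features \<Phi> Y l =
    (1 / real CARD('n)) * (centering ** gram K X Y ** centering) $ k $ l"
proof -
  let ?J = "centering :: real^'n^'n"
  have J: "?J $ l $ j = ?J $ j $ l" for j
    using arg_cong[OF transpose_centering, of "\<lambda>A. A $ j $ l"] by (simp add: transpose_def)
  have Y: "centered_features \<Phi> Y l =
      (1 / sqrt (real CARD('n))) *\<^sub>R (\<Sum>j\<in>UNIV. ?J $ j $ l *\<^sub>R \<Phi> (Y j))"
    unfolding centered_features_def by (subst J) (rule refl)
  have "centered_features \<Phi> X k \<bullet> centered_features \<Phi> Y l =
      (1 / real CARD('n)) * (\<Sum>j\<in>UNIV. \<Sum>i\<in>UNIV. ?J $ k $ i * K (X i) (Y j) * ?J $ j $ l)"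
    unfolding Y unfolding centered_features_def inner_scaleR_left inner_scaleR_right inner_sum_right
    by (simp add: inner_sum_left sum_distrib_left K mult_ac sum_divide_distrib)
  then show ?thesis
    by (simp add: matrix_matrix_mult_def gram_def sum_distrib_right)
qed

section \<open>Rotating frames by orthogonal matrices\<close>

lemma sum_orthogonal_mult:
  assumes "orthogonal_matrix (Q :: real^'n^'n)"
  shows "(\<Sum>i\<in>UNIV. Q $ k $ i * Q $ n $ i) = (if k = n then 1 else 0)"
proof -
  have "(\<Sum>i\<in>UNIV. Q $ k $ i * Q $ n $ i) = (Q ** transpose Q) $ k $ n"
    by (simp add: matrix_matrix_mult_def transpose_def)
  then show ?thesis using assms by (simp add: orthogonal_matrix_def mat_def)
qed

text \<open>Orthonormality of the rows of \<open>Q\<close> cancels the mixed terms. Values in a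
  vector space let the covariance and the sum of squared norms be two instances.\<close>

lemma bilinear_rotated_frame:
  fixes Q :: "real^'n^'n" and B :: "'n \<Rightarrow> 'n \<Rightarrow> 'b::real_vector"
  assumes "orthogonal_matrix Q"
  shows "(\<Sum>i\<in>UNIV. \<Sum>k\<in>UNIV. \<Sum>n\<in>UNIV. (Q $ k $ i * Q $ n $ i) *\<^sub>R B k n) = (\<Sum>k\<in>UNIV. B k k)"
proof -
  have "(\<Sum>i\<in>UNIV. \<Sum>k\<in>UNIV. \<Sum>n\<in>UNIV. (Q $ k $ i * Q $ n $ i) *\<^sub>R B k n) =
      (\<Sum>k\<in>UNIV. \<Sum>i\<in>UNIV. \<Sum>n\<in>UNIV. (Q $ k $ i * Q $ n $ i) *\<^sub>R B k n)"
    by (rule sum.swap)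
  also have "\<dots> = (\<Sum>k\<in>UNIV. \<Sum>n\<in>UNIV. \<Sum>i\<in>UNIV. (Q $ k $ i * Q $ n $ i) *\<^sub>R B k n)"
    by (intro sum.cong refl sum.swap)
  also have "\<dots> = (\<Sum>k\<in>UNIV. \<Sum>n\<in>UNIV. (if k = n then 1 else 0) *\<^sub>R B k n)"
    by (simp only: scaleR_sum_left[symmetric] sum_orthogonal_mult[OF assms])
  also have "\<dots> = (\<Sum>k\<in>UNIV. \<Sum>n\<in>UNIV. if n = k then B k k else 0)"
    by (intro sum.cong refl) auto
  finally show ?thesis by simp
qed

definition rotate_frame :: "real^'n^'n \<Rightarrow> ('n \<Rightarrow> 'h::real_vector) \<Rightarrow> 'n \<Rightarrow> 'h" where
  "rotate_frame Q a i = (\<Sum>k\<in>UNIV. Q $ k $ i *\<^sub>R a k)"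

text \<open>A covariance determines its frame only up to rotation, so \<open>Q\<close> may be chosen
  to meet the diagonality hypothesis of \<open>OT_eps_gaussian\<close>.\<close>

lemma frame_op_rotate_frame:
  assumes "orthogonal_matrix Q"
  shows "frame_op (rotate_frame Q a) = frame_op a"
proof
  fix h
  have "frame_op (rotate_frame Q a) h =
      (\<Sum>i\<in>UNIV. \<Sum>k\<in>UNIV. \<Sum>n\<in>UNIV. (Q $ k $ i * Q $ n $ i) *\<^sub>R ((a n \<bullet> h) *\<^sub>R a k))"
    unfolding frame_op_def rotate_frame_def
    by (simp add: inner_sum_left scaleR_sum_left scaleR_sum_right sum_distrib_left mult_ac)
  then show "frame_op (rotate_frame Q a) h = frame_op a h"
    unfolding bilinear_rotated_frame[OF assms] by (simp add: frame_op_def)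
qed

lemma norm_rotate_frame:
  fixes a :: "'n::finite \<Rightarrow> 'h::real_inner"
  assumes "orthogonal_matrix Q"
  shows "(\<Sum>i\<in>UNIV. (norm (rotate_frame Q a i))\<^sup>2) = (\<Sum>k\<in>UNIV. (norm (a k))\<^sup>2)"
proof -
  have "(\<Sum>i\<in>UNIV. (norm (rotate_frame Q a i))\<^sup>2) =
      (\<Sum>i\<in>UNIV. \<Sum>k\<in>UNIV. \<Sum>n\<in>UNIV. (Q $ k $ i * Q $ n $ i) *\<^sub>R (a k \<bullet> a n))"
    unfolding power2_norm_eq_inner rotate_frame_def inner_sum_left
    by (simp add: inner_sum_right mult_ac sum_distrib_left)
  then show ?thesis
    unfolding bilinear_rotated_frame[OF assms] by (simp add: power2_norm_eq_inner)
qed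

text \<open>Reduces that diagonality to diagonalising \<open>M ** transpose M\<close>, where
  \<open>M\<close> is the matrix of inner products between the two frames.\<close>

lemma frame_op_rotate_frame_inner:
  fixes M :: "real^'n^'n"
  assumes M: "\<And>k l. M $ k $ l = a k \<bullet> b l"
  shows "frame_op b (rotate_frame Q a i) \<bullet> rotate_frame Q a j =
    (transpose Q ** (M ** transpose M) ** Q) $ i $ j"
proof -
  have "b l \<bullet> rotate_frame Q a i = (transpose Q ** M) $ i $ l" for i l
    by (simp add: rotate_frame_def inner_sum_right matrix_matrix_mult_def transpose_def M inner_commute)
  then have "frame_op b (rotate_frame Q a i) \<bullet> rotate_frame Q a j =
      ((transpose Q ** M) ** transpose (transpose Q ** M)) $ i $ j"
    by (simp add: frame_op_inner matrix_matrix_mult_def[of "transpose Q ** M"] transpose_def[of "transpose Q ** M"])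
  also have "(transpose Q ** M) ** transpose (transpose Q ** M) = transpose Q ** (M ** transpose M) ** Q"
    by (simp add: matrix_transpose_mul matrix_mul_assoc)
  finally show ?thesis .
qed

text \<open>This is P of the final statement; keeping both point families as arguments makes the
  self terms the case of equal families.\<close>

definition cross_gram :: "('x \<Rightarrow> 'x \<Rightarrow> real) \<Rightarrow> ('n::finite \<Rightarrow> 'x) \<Rightarrow> ('n \<Rightarrow> 'x) \<Rightarrow> real^'n^'n" where
  "cross_gram K X Y = centering ** gram K X Y ** centering ** transpose (gram K X Y) ** centering"

lemma cross_gram_eq_square:
  "cross_gram K X Y =
    (centering ** gram K X Y ** centering) ** transpose (centering ** gram K X Y ** centering)"
proof -
  have "(centering ** gram K X Y ** centering) ** transpose (centering ** gram K X Y ** centering) =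
      centering ** gram K X Y ** (centering ** centering) ** transpose (gram K X Y) ** centering"
    by (simp add: matrix_transpose_mul matrix_mul_assoc)
  then show ?thesis by (simp only: cross_gram_def centering_idem)
qed

lemma psd_mult_transpose: "psd_matrix (A ** transpose A)" for A :: "real^'n^'n"
proof -
  have "psd_matrix (mat 1 :: real^'n^'n)" by (simp add: mat_1_eq_diagonal psd_diagonal)
  from psd_congruence[OF this, of "transpose A"] show ?thesis by simp
qed

lemma psd_cross_gram: "psd_matrix (cross_gram K X Y)"
  unfolding cross_gram_eq_square by (rule psd_mult_transpose)

lemma psd_matrix_diagonalizable:
  fixes A :: "real^'n^'n"
  assumes A: "psd_matrix A"
  obtains Q l where "orthogonal_matrix Q" "A = Q ** diagonal l ** transpose Q" "\<And>i. 0 \<le> l i"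
proof -
  obtain Q l where Q: "orthogonal_matrix Q" and eq: "A = Q ** diagonal l ** transpose Q"
    using symmetric_matrix_diagonalizable A by (metis psd_matrix_def)
  have "transpose Q ** A ** Q = diagonal l"
    using Q unfolding eq by (simp add: orthogonal_matrix_def matrix_mul_assoc)
      (simp add: orthogonal_matrix_def flip: matrix_mul_assoc)
  then have "\<forall>i. 0 \<le> l i" using psd_congruence[OF A, of Q] by (simp add: psd_diagonal)
  then show thesis using that Q eq by blast
qed

lemma sum_norm_centered_features:
  fixes X :: "'n::finite \<Rightarrow> 'x"
  assumes K: "\<And>x y. K x y = \<Phi> x \<bullet> \<Phi> y"
  shows "(\<Sum>k\<in>UNIV. (norm (centered_features \<Phi> X k))\<^sup>2) = (1 / real CARD('n)) * trace (gram K X X ** centering)"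
proof -
  have "(\<Sum>k\<in>UNIV. (norm (centered_features \<Phi> X k))\<^sup>2) =
      (1 / real CARD('n)) * trace (centering ** gram K X X ** centering)"
    by (simp add: power2_norm_eq_inner inner_centered_features[OF K] trace_def sum_divide_distrib)
  also have "trace (centering ** gram K X X ** centering) = trace (gram K X X ** centering)"
    by (metis centering_idem matrix_mul_assoc trace_mul_sym)
  finally show ?thesis .
qed

theorem OT_eps_empirical:
  fixes \<Phi> :: "'x \<Rightarrow> 'h::{real_inner, second_countable_topology}" and X Y :: "'n::finite \<Rightarrow> 'x"
  assumes K: "\<And>x y. K x y = \<Phi> x \<bullet> \<Phi> y"
    and G0: "is_gaussian \<mu> (emp_mean \<Phi> X) (emp_cov \<Phi> X)"
    and G1: "is_gaussian \<nu> (emp_mean \<Phi> Y) (emp_cov \<Phi> Y)" and \<epsilon>: "0 < \<epsilon>"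
  shows "OT_eps \<epsilon> \<mu> \<nu> = ereal ((norm (emp_mean \<Phi> X - emp_mean \<Phi> Y))\<^sup>2
    + (1 / real CARD('n)) * trace (gram K X X ** centering) + (1 / real CARD('n)) * trace (gram K Y Y ** centering)
    + entropic_term \<epsilon> (16 / (\<epsilon>\<^sup>2 * (real CARD('n))\<^sup>2)) (cross_gram K X Y))"
proof -
  let ?m = "real CARD('n)"
  let ?a = "centered_features \<Phi> X" and ?b = "centered_features \<Phi> Y"
  obtain Q l where Q: "orthogonal_matrix Q" and P: "cross_gram K X Y = Q ** diagonal l ** transpose Q"
    and l: "\<And>i. 0 \<le> l i"
    using psd_matrix_diagonalizable[OF psd_cross_gram] by blast
  have QQ: "transpose Q ** Q = mat 1" using Q by (simp add: orthogonal_matrix_def)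
  define M :: "real^'n^'n" where "M = (1 / ?m) *\<^sub>R (centering ** gram K X Y ** centering)"
  have M: "M $ k $ n = ?a k \<bullet> ?b n" for k n
    by (simp add: M_def inner_centered_features[OF K])
  \<comment> \<open>Each factor carries 1/m, so the eigenvalues fed to
    \<open>OT_eps_gaussian\<close> are those of \<open>cross_gram\<close> over m^2; this turns 16 /
    eps^2 into c.\<close>
  have "M ** transpose M = (1 / ?m\<^sup>2) *\<^sub>R cross_gram K X Y"
    unfolding cross_gram_eq_square M_def
    by (simp add: transpose_scalar matrix_scalar_ac scalar_matrix_assoc[symmetric] power2_eq_square)
  then have "transpose Q ** (M ** transpose M) ** Q = (1 / ?m\<^sup>2) *\<^sub>R (transpose Q ** (Q ** diagonal l ** transpose Q) ** Q)"
    unfolding P by (simp add: matrix_scalar_ac scalar_matrix_assoc[symmetric])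
  also have "transpose Q ** (Q ** diagonal l ** transpose Q) ** Q = (transpose Q ** Q) ** diagonal l ** (transpose Q ** Q)"
    by (simp only: matrix_mul_assoc)
  finally have "transpose Q ** (M ** transpose M) ** Q = diagonal (\<lambda>i. l i / ?m\<^sup>2)"
    by (simp add: QQ diagonal_scaleR)
  then have diag: "frame_op ?b (rotate_frame Q ?a i) \<bullet> rotate_frame Q ?a j = (if i = j then l i / ?m\<^sup>2 else 0)" for i j
    unfolding frame_op_rotate_frame_inner[OF M] by (simp add: diagonal_def)
  have G0': "is_gaussian \<mu> (emp_mean \<Phi> X) (frame_op (rotate_frame Q ?a))"
    using G0 by (simp add: frame_op_rotate_frame[OF Q] emp_cov_eq_frame_op)
  have G1': "is_gaussian \<nu> (emp_mean \<Phi> Y) (frame_op ?b)"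
    using G1 by (simp add: emp_cov_eq_frame_op)
  have "entropic_term \<epsilon> (16 / (\<epsilon>\<^sup>2 * ?m\<^sup>2)) (cross_gram K X Y) =
      (\<Sum>i\<in>UNIV. - (\<epsilon>/2) * (sqrt (1 + 16 / \<epsilon>\<^sup>2 * (l i / ?m\<^sup>2)) - 1)
        + (\<epsilon>/2) * ln ((1 + sqrt (1 + 16 / \<epsilon>\<^sup>2 * (l i / ?m\<^sup>2))) / 2))"
    unfolding P by (subst entropic_term_conjugate_diagonal[OF Q l]) simp_all
  then show ?thesis
    using OT_eps_gaussian[OF G0' G1' diag \<epsilon>]
    by (simp only: norm_rotate_frame[OF Q] sum_norm_centered_features[OF K])
qed

section \<open>Mean term, self terms and limits of the divergence\<close>

lemma norm_emp_mean_diff: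
  fixes \<Phi> :: "'x \<Rightarrow> 'h::real_inner" and X Y :: "'n::finite \<Rightarrow> 'x"
  assumes K: "\<And>x y. K x y = \<Phi> x \<bullet> \<Phi> y"
  shows "(norm (emp_mean \<Phi> X - emp_mean \<Phi> Y))\<^sup>2 = (1 / (real CARD('n))\<^sup>2)
    * ((vec 1 :: real^'n) \<bullet> ((gram K X X + gram K Y Y - 2 *\<^sub>R gram K X Y) *v vec 1))"
proof -
  have gram_sum: "(vec 1 :: real^'n) \<bullet> (gram K V W *v vec 1) = (\<Sum>i\<in>UNIV. \<Phi> (V i)) \<bullet> (\<Sum>j\<in>UNIV. \<Phi> (W j))"
    for V W :: "'n \<Rightarrow> 'x"
    unfolding inner_sum_left by (simp add: inner_vec_def matrix_vector_mult_def gram_def K inner_sum_right)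
  let ?x = "\<Sum>i\<in>UNIV. \<Phi> (X i)" and ?y = "\<Sum>i\<in>UNIV. \<Phi> (Y i)"
  have "emp_mean \<Phi> X - emp_mean \<Phi> Y = (1 / real CARD('n)) *\<^sub>R (?x - ?y)"
    by (simp add: emp_mean_def scaleR_diff_right)
  then have "(norm (emp_mean \<Phi> X - emp_mean \<Phi> Y))\<^sup>2 = (1 / (real CARD('n))\<^sup>2) * (?x \<bullet> ?x + ?y \<bullet> ?y - 2 * (?x \<bullet> ?y))"
    by (simp add: power_divide power2_norm_eq_inner[symmetric])
      (simp add: power2_norm_eq_inner inner_diff_left inner_diff_right inner_commute)
  then show ?thesis
    by (simp only: matrix_vector_mult_add_rdistrib matrix_vector_mult_diff_rdistrib inner_add_right
        inner_diff_right inner_scaleR_right gram_sum scaleR_matrix_vector_assoc[symmetric])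
qed

lemma gram_centered_square:
  assumes "\<And>x y. K x y = \<Phi> x \<bullet> (\<Phi> y :: 'h::real_inner)"
  shows "cross_gram K X X = (centering ** gram K X X ** centering) ** (centering ** gram K X X ** centering)"
proof -
  have "transpose (gram K X X) = gram K X X"
    by (simp add: vec_eq_iff transpose_def gram_def assms inner_commute)
  then show ?thesis
    by (simp add: cross_gram_eq_square matrix_transpose_mul matrix_mul_assoc)
qed

lemma psd_gram_centered:
  fixes X :: "'n::finite \<Rightarrow> 'x"
  assumes K: "\<And>x y. K x y = \<Phi> x \<bullet> (\<Phi> y :: 'h::real_inner)"
  shows "psd_matrix (centering ** gram K X X ** centering)"
proof -
  have "v \<bullet> (gram K X X *v v) = (\<Sum>i\<in>UNIV. v $ i *\<^sub>R \<Phi> (X i)) \<bullet> (\<Sum>i\<in>UNIV. v $ i *\<^sub>R \<Phi> (X i))" for v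
    unfolding inner_sum_left
    by (simp add: inner_vec_def matrix_vector_mult_def gram_def K inner_sum_right sum_distrib_left mult_ac)
  moreover have "transpose (gram K X X) = gram K X X"
    by (simp add: vec_eq_iff transpose_def gram_def K inner_commute)
  ultimately have "psd_matrix (gram K X X)" by (simp add: psd_matrix_def)
  from psd_congruence[OF this, of centering] show ?thesis by simp
qed

text \<open>For equal families the cross matrix is the square of the centred Gram matrix, which is
  itself positive semidefinite and hence the root. In the limit at 0 this turns the self terms into
  the traces (1/m) Tr(K J).\<close>

lemma trace_sqrt_cross_gram_self:
  assumes K: "\<And>x y. K x y = \<Phi> x \<bullet> (\<Phi> y :: 'h::real_inner)"
  shows "trace (matrix_sqrt (cross_gram K X X)) = trace (gram K X X ** centering)"
proof -
  have "matrix_sqrt (cross_gram K X X) = centering ** gram K X X ** centering"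
    unfolding gram_centered_square[OF K] by (rule matrix_sqrt_square[OF psd_gram_centered[OF K]])
  then show ?thesis by (metis centering_idem matrix_mul_assoc trace_mul_sym)
qed

text \<open>For large \<open>\<epsilon>\<close> the root is 1 + O(1/eps^2), so both parts are
  O(1/eps). Near 0 it grows like sqrt(q) / eps: the first part tends to - sqrt(q) / 2, and eps times
  a logarithm of 1/eps vanishes. The case q = 0 is separate because the expansions require a
  positive q.\<close>

lemma
  fixes q :: real
  assumes "0 \<le> q"
  shows entropic_summand_at_top: "((\<lambda>\<epsilon>. - (\<epsilon>/2) * (sqrt (1 + q / \<epsilon>\<^sup>2) - 1) + (\<epsilon>/2) * ln ((1 + sqrt (1 + q / \<epsilon>\<^sup>2)) / 2)) \<longlongrightarrow> 0) at_top"
    and entropic_summand_at_right_0: "((\<lambda>\<epsilon>. - (\<epsilon>/2) * (sqrt (1 + q / \<epsilon>\<^sup>2) - 1) + (\<epsilon>/2) * ln ((1 + sqrt (1 + q / \<epsilon>\<^sup>2)) / 2))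
      \<longlongrightarrow> - sqrt q / 2) (at_right 0)"
proof -
  show "((\<lambda>\<epsilon>. - (\<epsilon>/2) * (sqrt (1 + q / \<epsilon>\<^sup>2) - 1) + (\<epsilon>/2) * ln ((1 + sqrt (1 + q / \<epsilon>\<^sup>2)) / 2)) \<longlongrightarrow> 0) at_top"
  proof (cases "q = 0")
    case False
    then have "0 < q" using assms by simp
    then show ?thesis by real_asymp
  qed simp
  show "((\<lambda>\<epsilon>. - (\<epsilon>/2) * (sqrt (1 + q / \<epsilon>\<^sup>2) - 1) + (\<epsilon>/2) * ln ((1 + sqrt (1 + q / \<epsilon>\<^sup>2)) / 2))
      \<longlongrightarrow> - sqrt q / 2) (at_right 0)"
  proof (cases "q = 0")
    case False
    then have "0 < q" using assms by simp
    then show ?thesis by real_asymp (simp add: powr_half_sqrt)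
  qed simp
qed

lemma
  fixes P :: "real^'n^'n"
  assumes P: "psd_matrix P" and m: "0 < m"
  shows entropic_term_at_top: "((\<lambda>\<epsilon>. entropic_term \<epsilon> (16 / (\<epsilon>\<^sup>2 * m\<^sup>2)) P) \<longlongrightarrow> 0) at_top"
    and entropic_term_at_right_0:
      "((\<lambda>\<epsilon>. entropic_term \<epsilon> (16 / (\<epsilon>\<^sup>2 * m\<^sup>2)) P) \<longlongrightarrow> - (2 / m) * trace (matrix_sqrt P)) (at_right 0)"
proof -
  obtain Q l where Q: "orthogonal_matrix Q" and PQ: "P = Q ** diagonal l ** transpose Q" and l: "\<And>i. 0 \<le> l i"
    using psd_matrix_diagonalizable[OF P] by blast
  \<comment> \<open>The scaling that makes c times the eigenvalue equal to q / eps^2; its root gives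
    sqrt(q) / 2 = 2 sqrt(l) / m and hence the factor 2/m.\<close>
  define q where "q i = 16 * l i / m\<^sup>2" for i
  have q: "0 \<le> q i" for i using l by (simp add: q_def)
  have c: "16 / (\<epsilon>\<^sup>2 * m\<^sup>2) * l i = q i / \<epsilon>\<^sup>2" for \<epsilon> i by (simp add: q_def)
  have eq: "entropic_term \<epsilon> (16 / (\<epsilon>\<^sup>2 * m\<^sup>2)) P = (\<Sum>i\<in>UNIV. - (\<epsilon>/2) * (sqrt (1 + q i / \<epsilon>\<^sup>2) - 1)
      + (\<epsilon>/2) * ln ((1 + sqrt (1 + q i / \<epsilon>\<^sup>2)) / 2))" for \<epsilon>
    unfolding PQ by (subst entropic_term_conjugate_diagonal[OF Q l]) (simp_all only: c, simp)
  show "((\<lambda>\<epsilon>. entropic_term \<epsilon> (16 / (\<epsilon>\<^sup>2 * m\<^sup>2)) P) \<longlongrightarrow> 0) at_top"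
    unfolding eq by (rule tendsto_null_sum, rule entropic_summand_at_top[OF q])
  have "sqrt (q i) / 2 = 2 / m * sqrt (l i)" for i
    using m by (simp add: q_def real_sqrt_divide real_sqrt_mult)
  then have "(\<Sum>i\<in>UNIV. - sqrt (q i) / 2) = - (2 / m) * (\<Sum>i\<in>UNIV. sqrt (l i))"
    by (simp add: sum_negf sum_distrib_left)
  also have "\<dots> = - (2 / m) * trace (matrix_sqrt P)"
    unfolding PQ matrix_sqrt_conjugate_diagonal[OF Q l] trace_conjugate[OF Q] trace_diagonal ..
  finally have limit: "(\<Sum>i\<in>UNIV. - sqrt (q i) / 2) = - (2 / m) * trace (matrix_sqrt P)" .
  show "((\<lambda>\<epsilon>. entropic_term \<epsilon> (16 / (\<epsilon>\<^sup>2 * m\<^sup>2)) P) \<longlongrightarrow> - (2 / m) * trace (matrix_sqrt P)) (at_right 0)"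
    unfolding eq limit[symmetric] by (rule tendsto_sum, rule entropic_summand_at_right_0[OF q])
qed

text \<open>A self cost has no mean term and carries its trace term twice, so halving and
  subtracting removes exactly the traces in the mixed cost.\<close>

lemma S_eps_empirical:
  fixes \<Phi> :: "'x \<Rightarrow> 'h::{real_inner, second_countable_topology}" and X Y :: "'n::finite \<Rightarrow> 'x"
  assumes K: "\<And>x y. K x y = \<Phi> x \<bullet> \<Phi> y"
    and G0: "is_gaussian \<mu> (emp_mean \<Phi> X) (emp_cov \<Phi> X)"
    and G1: "is_gaussian \<nu> (emp_mean \<Phi> Y) (emp_cov \<Phi> Y)" and \<epsilon>: "0 < \<epsilon>"
  defines "c \<equiv> 16 / (\<epsilon>\<^sup>2 * (real CARD('n))\<^sup>2)"
  shows "S_eps \<epsilon> \<mu> \<nu> = ereal ((norm (emp_mean \<Phi> X - emp_mean \<Phi> Y))\<^sup>2 + entropic_term \<epsilon> c (cross_gram K X Y)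
    - entropic_term \<epsilon> c (cross_gram K X X) / 2 - entropic_term \<epsilon> c (cross_gram K Y Y) / 2)"
proof -
  have half: "ereal x / 2 = ereal (x / 2)" for x
    using ereal_divide[of x 2] by simp
  show ?thesis
    unfolding S_eps_def OT_eps_empirical[OF K G0 G1 \<epsilon>] OT_eps_empirical[OF K G0 G0 \<epsilon>]
      OT_eps_empirical[OF K G1 G1 \<epsilon>] c_def
    by (simp add: half) (simp add: field_simps)
qed

theorem mainTheorem19:
  fixes K :: "'x::polish_space \<Rightarrow> 'x \<Rightarrow> real"
    and \<Phi> :: "'x \<Rightarrow> 'h::{real_inner, complete_space, second_countable_topology}"
    and X Y :: "'m::finite \<Rightarrow> 'x"
    and \<mu>0 \<mu>1 :: "'h measure"
  assumes K_cont: "continuous_on UNIV (\<lambda>(x, y). K x y)"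
    and K_pd: "pos_def_kernel K"
    and RKHS: "is_RKHS_feature_map K \<Phi>"
    and G0: "is_gaussian \<mu>0 (emp_mean \<Phi> X) (emp_cov \<Phi> X)"
    and G1: "is_gaussian \<mu>1 (emp_mean \<Phi> Y) (emp_cov \<Phi> Y)"
  defines "m \<equiv> real CARD('m)"
    and "J \<equiv> (centering :: real^'m^'m)"
    and "KX \<equiv> gram K X X" and "KY \<equiv> gram K Y Y" and "KXY \<equiv> gram K X Y"
    and "I \<equiv> (mat 1 :: real^'m^'m)"
    and "one \<equiv> (vec 1 :: real^'m)"
  shows
    "let P = J ** KXY ** J ** transpose KXY ** J;
         D = (1 / m\<^sup>2) * (one \<bullet> ((KX + KY - 2 *\<^sub>R KXY) *v one)) in
     (\<forall>\<epsilon>>0. let c = 16 / (\<epsilon>\<^sup>2 * m\<^sup>2) in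
        OT_eps \<epsilon> \<mu>0 \<mu>1 = ereal (D + (1/m) * trace (KX ** J) + (1/m) * trace (KY ** J)
          - (\<epsilon>/2) * trace (- I + matrix_sqrt (I + c *\<^sub>R P))
          + (\<epsilon>/2) * ln (det ((1/2) *\<^sub>R I + (1/2) *\<^sub>R matrix_sqrt (I + c *\<^sub>R P))))
      \<and> S_eps \<epsilon> \<mu>0 \<mu>1 = ereal (D
          + (\<epsilon>/4) * trace (- I + matrix_sqrt (I + c *\<^sub>R ((J ** KX ** J) ** (J ** KX ** J))))
          + (\<epsilon>/4) * trace (- I + matrix_sqrt (I + c *\<^sub>R ((J ** KY ** J) ** (J ** KY ** J))))
          - (\<epsilon>/2) * trace (- I + matrix_sqrt (I + c *\<^sub>R P))
          + (\<epsilon>/2) * ln (det ((1/2) *\<^sub>R I + (1/2) *\<^sub>R matrix_sqrt (I + c *\<^sub>R P)))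
          - (\<epsilon>/4) * ln (det ((1/2) *\<^sub>R I + (1/2) *\<^sub>R
                matrix_sqrt (I + c *\<^sub>R ((J ** KX ** J) ** (J ** KX ** J)))))
          - (\<epsilon>/4) * ln (det ((1/2) *\<^sub>R I + (1/2) *\<^sub>R
                matrix_sqrt (I + c *\<^sub>R ((J ** KY ** J) ** (J ** KY ** J)))))))
     \<and> ((\<lambda>\<epsilon>. S_eps \<epsilon> \<mu>0 \<mu>1) \<longlongrightarrow> ereal ((norm (emp_mean \<Phi> X - emp_mean \<Phi> Y))\<^sup>2)) at_top
     \<and> (norm (emp_mean \<Phi> X - emp_mean \<Phi> Y))\<^sup>2 = D
     \<and> ((\<lambda>\<epsilon>. S_eps \<epsilon> \<mu>0 \<mu>1) \<longlongrightarrow>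
          ereal (D + (1/m) * trace (KX ** J) + (1/m) * trace (KY ** J)
                 - (2/m) * trace (matrix_sqrt P))) (at_right 0)"
proof -
  have K: "K x y = \<Phi> x \<bullet> \<Phi> y" for x y using RKHS by (simp add: is_RKHS_feature_map_def)
  define D where "D = (1 / m\<^sup>2) * (one \<bullet> ((KX + KY - 2 *\<^sub>R KXY) *v one))"
  define P where "P = J ** KXY ** J ** transpose KXY ** J"
  \<comment> \<open>A real-valued version of the divergence, valid for positive
    \<open>\<epsilon>\<close>: limits are computed in the reals and lifted to \<open>ereal\<close>,
    and agreement along each filter is enough.\<close>
  define S where "S \<epsilon> = D + entropic_term \<epsilon> (16 / (\<epsilon>\<^sup>2 * m\<^sup>2)) P
    - entropic_term \<epsilon> (16 / (\<epsilon>\<^sup>2 * m\<^sup>2)) (cross_gram K X X) / 2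
    - entropic_term \<epsilon> (16 / (\<epsilon>\<^sup>2 * m\<^sup>2)) (cross_gram K Y Y) / 2" for \<epsilon>
  have m: "0 < m" by (simp add: m_def)
  have D: "(norm (emp_mean \<Phi> X - emp_mean \<Phi> Y))\<^sup>2 = D"
    unfolding D_def m_def one_def KX_def KY_def KXY_def by (rule norm_emp_mean_diff[OF K])
  have P: "cross_gram K X Y = P" by (simp add: cross_gram_def P_def J_def KXY_def)
  have PX: "cross_gram K X X = (J ** KX ** J) ** (J ** KX ** J)"
    and PY: "cross_gram K Y Y = (J ** KY ** J) ** (J ** KY ** J)"
    unfolding J_def KX_def KY_def by (rule gram_centered_square[OF K])+
  have psd: "psd_matrix P" using psd_cross_gram P by metis
  have OT: "OT_eps \<epsilon> \<mu>0 \<mu>1 = ereal (D + (1/m) * trace (KX ** J) + (1/m) * trace (KY ** J)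
      + entropic_term \<epsilon> (16 / (\<epsilon>\<^sup>2 * m\<^sup>2)) P)" if "0 < \<epsilon>" for \<epsilon>
    using OT_eps_empirical[OF K G0 G1 that] by (simp only: D P KX_def KY_def J_def m_def)
  have S: "S_eps \<epsilon> \<mu>0 \<mu>1 = ereal (S \<epsilon>)" if "0 < \<epsilon>" for \<epsilon>
    using S_eps_empirical[OF K G0 G1 that] by (simp only: D P S_def m_def)
  have "(S \<longlongrightarrow> D + 0 - 0 / 2 - 0 / 2) at_top"
    unfolding S_def by (intro tendsto_intros entropic_term_at_top psd psd_cross_gram m) simp_all
  then have "((\<lambda>\<epsilon>. ereal (S \<epsilon>)) \<longlongrightarrow> ereal D) at_top" by (simp add: lim_ereal)
  moreover have "\<forall>\<^sub>F \<epsilon> in at_top. ereal (S \<epsilon>) = S_eps \<epsilon> \<mu>0 \<mu>1"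
    using eventually_gt_at_top[of 0] by eventually_elim (simp add: S)
  ultimately have top: "((\<lambda>\<epsilon>. S_eps \<epsilon> \<mu>0 \<mu>1) \<longlongrightarrow> ereal D) at_top"
    by (rule Lim_transform_eventually)
  \<comment> \<open>The weight -1/2 of the self terms turns their limits into +1/m times a trace of
    a square root, which \<open>trace_sqrt_cross_gram_self\<close> evaluates.\<close>
  have "(S \<longlongrightarrow> D + - (2 / m) * trace (matrix_sqrt P)
      - (- (2 / m) * trace (matrix_sqrt (cross_gram K X X))) / 2
      - (- (2 / m) * trace (matrix_sqrt (cross_gram K Y Y))) / 2) (at_right 0)"
    unfolding S_def by (intro tendsto_intros entropic_term_at_right_0 psd psd_cross_gram m) simp_all
  then have "((\<lambda>\<epsilon>. ereal (S \<epsilon>)) \<longlongrightarrow> ereal (D + (1/m) * trace (KX ** J) + (1/m) * trace (KY ** J)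
      - (2/m) * trace (matrix_sqrt P))) (at_right 0)"
    unfolding trace_sqrt_cross_gram_self[OF K] by (simp add: lim_ereal KX_def KY_def J_def algebra_simps)
  moreover have "\<forall>\<^sub>F \<epsilon> in at_right 0. ereal (S \<epsilon>) = S_eps \<epsilon> \<mu>0 \<mu>1"
    using eventually_at_right_less[of 0] by eventually_elim (simp add: S)
  ultimately have zero: "((\<lambda>\<epsilon>. S_eps \<epsilon> \<mu>0 \<mu>1) \<longlongrightarrow> ereal (D + (1/m) * trace (KX ** J) + (1/m) * trace (KY ** J)
      - (2/m) * trace (matrix_sqrt P))) (at_right 0)"
    by (rule Lim_transform_eventually)
  show ?thesis
    unfolding Let_def D_def[symmetric] P_def[symmetric]
  proof (intro conjI allI impI)
    fix \<epsilon> :: real assume \<epsilon>: "0 < \<epsilon>"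
    let ?c = "16 / (\<epsilon>\<^sup>2 * m\<^sup>2)"
    show "OT_eps \<epsilon> \<mu>0 \<mu>1 = ereal (D + (1/m) * trace (KX ** J) + (1/m) * trace (KY ** J)
          - (\<epsilon>/2) * trace (- I + matrix_sqrt (I + ?c *\<^sub>R P))
          + (\<epsilon>/2) * ln (det ((1/2) *\<^sub>R I + (1/2) *\<^sub>R matrix_sqrt (I + ?c *\<^sub>R P))))"
      unfolding OT[OF \<epsilon>] entropic_term_def I_def by simp
    show "S_eps \<epsilon> \<mu>0 \<mu>1 = ereal (D
          + (\<epsilon>/4) * trace (- I + matrix_sqrt (I + ?c *\<^sub>R ((J ** KX ** J) ** (J ** KX ** J))))
          + (\<epsilon>/4) * trace (- I + matrix_sqrt (I + ?c *\<^sub>R ((J ** KY ** J) ** (J ** KY ** J))))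
          - (\<epsilon>/2) * trace (- I + matrix_sqrt (I + ?c *\<^sub>R P))
          + (\<epsilon>/2) * ln (det ((1/2) *\<^sub>R I + (1/2) *\<^sub>R matrix_sqrt (I + ?c *\<^sub>R P)))
          - (\<epsilon>/4) * ln (det ((1/2) *\<^sub>R I + (1/2) *\<^sub>R
                matrix_sqrt (I + ?c *\<^sub>R ((J ** KX ** J) ** (J ** KX ** J)))))
          - (\<epsilon>/4) * ln (det ((1/2) *\<^sub>R I + (1/2) *\<^sub>R
                matrix_sqrt (I + ?c *\<^sub>R ((J ** KY ** J) ** (J ** KY ** J))))))"
      unfolding S[OF \<epsilon>] S_def PX PY entropic_term_def I_def by (simp add: field_simps)
  qed (use top zero D in simp_all)
qed

end
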